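(* Let $A\in\mathbb{R}^{N\times N}$, $B\in\mathbb{R}^{N\times q}$, $x_0\in\mathbb{R}^N$, $T>0$ and $U\ge 0$. There exists a constant $C=C_{[A,B,x_0,T,U]}$, depending only on $A,B,x_0,T,U$ (and in particular not on the splitting, the probabilities, the temporal grid or the control), such that the following holds. Let $A=\sum_{m=1}^M A_m$ be any splitting, $(p_\omega)_{\omega=1}^{2^M}$ any probabilities assigned to the subsets of $\{1,\dots,M\}$, and $0=t_0<t_1<\dots<t_K=T$ any temporal grid with maximal spacing $h$, such that (1) $\langle x,A_mx\rangle\le 0$ for all $x\in\mathbb{R}^N$ and all $m\in\{1,\dots,M\}$, and (2) $\sum_{\omega=1}^{2^M}p_\omega=1$ and $\pi_m>0$ for all $m\in\{1,\dots,M\}$. Let $u_h:\Omega^K\to L^2(0,T;\mathbb{R}^q)$ be any control (which may depend on $\boldsymbol\omega$) with $|u_h(\boldsymbol\omega)|_{L^2(0,T;\mathbb{R}^q)}\le U$ for all $\boldsymbol\omega\in\Omega^K$. For each $\boldsymbol\omega\in\Omega^K$ let $x(\boldsymbol\omega,t)$ and $x_h(\boldsymbol\omega,t)$ solve $$\dot x(\boldsymbol\omega,t)=Ax(\boldsymbol\omega,t)+Bu_h(\boldsymbol\omega,t),\quad x(\boldsymbol\omega,0)=x_0,$$ $$\dot x_h(\boldsymbol\omega,t)=\mathcal{A}_h(\boldsymbol\omega,t)x_h(\boldsymbol\omega,t)+Bu_h(\boldsymbol\omega,t),\quad x_h(\boldsymbol\omega,0)=x_0,$$ and put $e_h(\boldsymbol\omega,t)=x_h(\boldsymbol\omega,t)-x(\boldsymbol\omega,t)$.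 Then for all $t\in[0,T]$ $$\mathbb{E}[|e_h(t)|^2]\le C\,h\,\mathrm{Var}[\mathcal{A}].$$
   Context: $|\cdot|$ is the Euclidean norm and $\|\cdot\|$ the induced operator norm of matrices; $L^2$-norms are built from the Euclidean norm. Randomized splitting. $S_1,\dots,S_{2^M}$ is an enumeration of all subsets of $\{1,\dots,M\}$ (including the empty set); $\Omega=\{1,\dots,2^M\}$. Subset $S_\omega$ is given probability $p_\omega\ge 0$. The probability that index $m$ is selected is $\pi_m=\sum_{\omega:\,m\in S_\omega}p_\omega$. The grid spacings are $h_k=t_k-t_{k-1}$ and $h=\max_k h_k$. For $\boldsymbol\omega=(\omega_1,\dots,\omega_K)\in\Omega^K$ define the piecewise constant matrix $$\mathcal{A}_h(\boldsymbol\omega,t)=\sum_{m\in S_{\omega_k}}\frac{A_m}{\pi_m},\qquad t\in[t_{k-1},t_k).$$ The indices $\omega_k$ are chosen independently, i.e. $\Omega^K$ carries the probabilities $p(\boldsymbol\omega)=p_{\omega_1}p_{\omega_2}\cdots p_{\omega_K}$, and $\mathbb{E}[X]=\sum_{\boldsymbol\omega\in\Omega^K}X(\boldsymbol\omega)p(\boldsymbol\omega)$ (the argument $\boldsymbol\omega$ is suppressed inside $\mathbb{E}$). Finally $$\mathrm{Var}[\mathcal{A}]=\sum_{\omega=1}^{2^M}\Bigl\|\sum_{m\in S_\omega}\frac{A_m}{\pi_m}-A\Bigr\|^2p_\omega .$$ *)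

theory Defs
  imports "HOL-Analysis.Analysis"
begin

text \<open>The induced operator norm; \<open>norm\<close> on \<open>real ^ 'n ^ 'n\<close> would be the Frobenius norm.\<close>

definition op_norm :: "real ^ 'n ^ 'm \<Rightarrow> real" where
  "op_norm A = onorm (\<lambda>v. A *v v)"

text \<open>Elements of \<open>L\<^sup>2(0,T)\<close> are represented by Lebesgue measurable functions whose
  values outside the open interval are irrelevant.\<close>

definition square_integrable_on :: "real \<Rightarrow> (real \<Rightarrow> 'a::euclidean_space) \<Rightarrow> bool" where
  "square_integrable_on T f \<longleftrightarrow>
     f \<in> borel_measurable (lebesgue_on {0<..<T}) \<and>
     integrable (lebesgue_on {0<..<T}) (\<lambda>t. (norm (f t))\<^sup>2)"

definition L2_norm :: "real \<Rightarrow> (real \<Rightarrow> 'a::euclidean_space) \<Rightarrow> real" where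
  "L2_norm T f = sqrt (\<integral>t. (norm (f t))\<^sup>2 \<partial>lebesgue_on {0<..<T})"

definition abs_continuous_on_interval :: "real \<Rightarrow> real \<Rightarrow> (real \<Rightarrow> 'a::metric_space) \<Rightarrow> bool" where
  "abs_continuous_on_interval a b f \<longleftrightarrow>
     (\<forall>\<epsilon>>0. \<exists>\<delta>>0. \<forall>(n::nat) l r.
        (\<forall>i<n. a \<le> l i \<and> l i \<le> r i \<and> r i \<le> b) \<and>
        disjoint_family_on (\<lambda>i. {l i<..<r i}) {..<n} \<and>
        (\<Sum>i<n. r i - l i) < \<delta>
        \<longrightarrow> (\<Sum>i<n. dist (f (l i)) (f (r i))) < \<epsilon>)"

text \<open>Since the controls are only square integrable and the coefficients may jump, the
  differential equations are understood in the sense of Caratheodory.\<close>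

definition solves_ivp ::
  "real \<Rightarrow> (real \<Rightarrow> 'a \<Rightarrow> 'a) \<Rightarrow> 'a \<Rightarrow> (real \<Rightarrow> 'a::euclidean_space) \<Rightarrow> bool" where
  "solves_ivp T F x0 x \<longleftrightarrow>
     abs_continuous_on_interval 0 T x \<and>
     x 0 = x0 \<and>
     (AE t in lebesgue_on {0..T}. (x has_vector_derivative F t (x t)) (at t within {0..T}))"

definition selection_prob :: "nat \<Rightarrow> (nat \<Rightarrow> nat set) \<Rightarrow> (nat \<Rightarrow> real) \<Rightarrow> nat \<Rightarrow> real" where
  "selection_prob M S p m = (\<Sum>\<omega> | \<omega> \<in> {1..2^M} \<and> m \<in> S \<omega>. p \<omega>)"

definition random_matrix ::
  "nat \<Rightarrow> (nat \<Rightarrow> nat set) \<Rightarrow> (nat \<Rightarrow> real) \<Rightarrow> (nat \<Rightarrow> real ^ 'n ^ 'n) \<Rightarrow> nat \<Rightarrow> real ^ 'n ^ 'n" where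
  "random_matrix M S p As \<omega> = (\<Sum>m\<in>S \<omega>. (1 / selection_prob M S p m) *\<^sub>R As m)"

definition splitting_variance ::
  "nat \<Rightarrow> (nat \<Rightarrow> nat set) \<Rightarrow> (nat \<Rightarrow> real) \<Rightarrow> (nat \<Rightarrow> real ^ 'n ^ 'n) \<Rightarrow> real ^ 'n ^ 'n \<Rightarrow> real" where
  "splitting_variance M S p As A =
     (\<Sum>\<omega> = 1..2^M. (op_norm (random_matrix M S p As \<omega> - A))\<^sup>2 * p \<omega>)"

definition max_spacing :: "nat \<Rightarrow> (nat \<Rightarrow> real) \<Rightarrow> real" where
  "max_spacing K t = (MAX k\<in>{1..K}. t k - t (k - 1))"

text \<open>On a strictly increasing grid at most one summand below is nonzero. At the final time
  \<open>t K\<close> the value is \<open>0\<close>, which is immaterial for the differential equation.\<close>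

definition split_matrix ::
  "nat \<Rightarrow> (nat \<Rightarrow> nat set) \<Rightarrow> (nat \<Rightarrow> real) \<Rightarrow> (nat \<Rightarrow> real ^ 'n ^ 'n) \<Rightarrow>
   nat \<Rightarrow> (nat \<Rightarrow> real) \<Rightarrow> (nat \<Rightarrow> nat) \<Rightarrow> real \<Rightarrow> real ^ 'n ^ 'n" where
  "split_matrix M S p As K t \<omega> s =
     (\<Sum>k = 1..K. indicator {t (k - 1)..<t k} s *\<^sub>R random_matrix M S p As (\<omega> k))"

definition sample_space :: "nat \<Rightarrow> nat \<Rightarrow> (nat \<Rightarrow> nat) set" where
  "sample_space M K = {1..K} \<rightarrow>\<^sub>E {1..2^M}"

definition expect :: "nat \<Rightarrow> (nat \<Rightarrow> real) \<Rightarrow> nat \<Rightarrow> ((nat \<Rightarrow> nat) \<Rightarrow> real) \<Rightarrow> real" where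
  "expect M p K X = (\<Sum>\<omega>\<in>sample_space M K. X \<omega> * (\<Prod>k = 1..K. p (\<omega> k)))"

end

theory Submission
  imports Defs
begin

text \<open>
  The control may depend on the whole sample \<open>\<sigma>\<close>, so the two trajectories cannot be compared step by
  step: the matrix drawn in one cell is not independent of the earlier trajectory. Duality removes
  the control. Fix a final time \<open>\<tau>\<close> and a unit vector \<open>v\<close>, and let \<open>\<psi>\<close> and \<open>\<phi>\<close> solve on \<open>[0, \<tau>]\<close> the
  backward equations \<open>\<psi>' = - \<A>\<^sub>h\<^sup>T \<psi>\<close> and \<open>\<phi>' = - A\<^sup>T \<phi>\<close> with the common final value \<open>v\<close>. Differentiating
  \<open>\<psi> \<bullet> x\<^sub>h\<close> and \<open>\<phi> \<bullet> x\<close> and subtracting (\<open>evolve_gap_duality\<close>) gives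

    \<open>v \<bullet> (x\<^sub>h(\<tau>) - x(\<tau>)) = (\<psi>(0) - \<phi>(0)) \<bullet> x\<^sub>0 + \<integral> (\<psi>(s) - \<phi>(s)) \<bullet> B u(s) ds\<close>,

  where \<open>\<psi> - \<phi>\<close> does not see the control. By the Cauchy-Schwarz inequality and the bound \<open>U\<close> on the
  control, it remains to estimate \<open>E |\<psi>(s) - \<phi>(s)|\<^sup>2\<close> for each fixed \<open>s\<close>; summing over an orthonormal
  basis of vectors \<open>v\<close> then costs a factor equal to the dimension.

  Both \<open>\<psi>(s)\<close> and \<open>\<phi>(s)\<close> are compositions of flows of constant dissipative maps over the lengths \<open>d\<^sub>k\<close>
  of the cells of the grid cut down to \<open>[s, \<tau>]\<close>, and such flows are contractions. In one cell, let \<open>D\<close>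
  be the random deviation, of mean zero. The random and the averaged flow differ by at most \<open>d |D|\<close>
  (\<open>norm_flow_diff_le\<close>), and the mean of this difference is at most \<open>d\<^sup>2 E|D|\<^sup>2 / 2\<close>
  (\<open>norm_mean_flow_diff_le\<close>), because its part of first order in \<open>D\<close> averages out. Expanding the square
  of the error cell by cell, independence turns the cross terms into these means, so each cell
  contributes at most \<open>3 d\<^sub>k\<^sup>2 Var\<close> (\<open>expect_evolve_diff_le\<close>); and
  \<open>\<Sum> d\<^sub>k\<^sup>2 \<le> h \<Sum> d\<^sub>k \<le> h T\<close>. Contractivity is what keeps all constants independent of the splitting,
  whose individual matrices may be arbitrarily large.
\<close>

section \<open>Flows of dissipative linear maps\<close>

text \<open>For linear \<open>L\<close> this is \<open>exp (t L) v\<close>.\<close>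

definition flow :: "('a::euclidean_space \<Rightarrow> 'a) \<Rightarrow> real \<Rightarrow> 'a \<Rightarrow> 'a" where
  "flow L t v = (\<Sum>n. (t ^ n / fact n) *\<^sub>R (L ^^ n) v)"

lemma norm_funpow_le:
  fixes L :: "'a::euclidean_space \<Rightarrow> 'a"
  assumes "linear L"
  shows "norm ((L ^^ n) v) \<le> onorm L ^ n * norm v"
proof (induction n)
  case (Suc n)
  have bl: "bounded_linear L"
    using assms by (simp add: linear_conv_bounded_linear)
  have "norm ((L ^^ Suc n) v) \<le> onorm L * norm ((L ^^ n) v)"
    using onorm[OF bl] by simp
  also have "\<dots> \<le> onorm L * (onorm L ^ n * norm v)"
    using Suc onorm_pos_le[OF bl] by (intro mult_left_mono)
  finally show ?case by (simp add: mult.assoc)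
qed simp

lemma flow_summable:
  fixes L :: "'a::euclidean_space \<Rightarrow> 'a"
  assumes "linear L"
  shows "summable (\<lambda>n. (t ^ n / fact n) *\<^sub>R (L ^^ n) v)"
proof (rule summable_comparison_test')
  have "summable (\<lambda>n. (inverse (fact n) * (\<bar>t\<bar> * onorm L) ^ n) * norm v)"
    by (intro summable_mult2 summable_exp)
  then show "summable (\<lambda>n. (\<bar>t\<bar> * onorm L) ^ n / fact n * norm v)"
    by (simp add: field_simps)
  show "norm ((t ^ n / fact n) *\<^sub>R (L ^^ n) v) \<le> (\<bar>t\<bar> * onorm L) ^ n / fact n * norm v" for n
    using mult_left_mono[OF norm_funpow_le[OF assms, of n v], of "\<bar>t\<bar> ^ n / fact n"]
    by (simp add: power_abs power_mult_distrib ac_simps)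
qed

lemma flow_0 [simp]: "flow L 0 v = v"
proof -
  have "(\<lambda>n. (0 ^ n / fact n) *\<^sub>R (L ^^ n) v) sums (\<Sum>n\<in>{0}. (0 ^ n / fact n) *\<^sub>R (L ^^ n) v)"
    by (rule sums_finite) auto
  then show ?thesis
    unfolding flow_def by (simp add: sums_iff)
qed

lemma linear_funpow:
  fixes L :: "'a::real_vector \<Rightarrow> 'a"
  assumes "linear L" shows "linear (L ^^ n)"
proof (induction n)
  case 0 then show ?case by (simp add: linear_id[unfolded id_def] id_def)
next
  case (Suc n)
  then show ?case using linear_compose[OF Suc assms] by (simp add: o_def)
qed

lemma linear_flow:
  assumes "linear L"
  shows "linear (flow L t)"
proof (rule linearI)
  note lin = linear_funpow[OF assms]
  show "flow L t (v + w) = flow L t v + flow L t w" for v w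
    unfolding flow_def
    by (subst suminf_add[OF flow_summable[OF assms] flow_summable[OF assms]])
       (simp add: linear_add[OF lin] scaleR_add_right)
  show "flow L t (c *\<^sub>R v) = c *\<^sub>R flow L t v" for c v
    unfolding flow_def
    by (subst suminf_scaleR_right[OF flow_summable[OF assms]])
       (simp add: linear_scale[OF lin] ac_simps)
qed

lemma flow_has_vector_derivative:
  assumes "linear L"
  shows "((\<lambda>s. flow L s v) has_vector_derivative L (flow L t v)) (at t within S)"
proof -
  have bl: "bounded_linear L"
    using assms by (simp add: linear_conv_bounded_linear)
  have inner_flow: "flow L s w \<bullet> b = (\<Sum>n. ((L ^^ n) w \<bullet> b / fact n) * s ^ n)"
    "summable (\<lambda>n. ((L ^^ n) w \<bullet> b / fact n) * s ^ n)" for s w b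
    unfolding flow_def
    using bounded_linear.suminf[OF bounded_linear_inner_left flow_summable[OF assms, of s w], of b]
      bounded_linear.summable[OF bounded_linear_inner_left flow_summable[OF assms, of s w], of b]
    by (simp_all add: mult.commute)
  have comp: "((\<lambda>s. flow L s v \<bullet> b) has_field_derivative flow L t (L v) \<bullet> b) (at t)" for b
  proof -
    define c where "c n = (L ^^ n) v \<bullet> b / fact n" for n
    have "diffs c n = (L ^^ n) (L v) \<bullet> b / fact n" for n
    proof -
      have "diffs c n = (real (Suc n) / fact (Suc n)) * ((L ^^ Suc n) v \<bullet> b)"
        by (simp add: diffs_def c_def)
      also have "real (Suc n) / fact (Suc n) = 1 / fact n"
        by (simp add: field_simps del: of_nat_Suc)
      finally show ?thesis
        by (simp add: funpow_swap1)
    qed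
    then have "(\<Sum>n. diffs c n * t ^ n) = flow L t (L v) \<bullet> b"
      by (simp add: inner_flow(1))
    moreover have "((\<lambda>s. \<Sum>n. c n * s ^ n) has_field_derivative (\<Sum>n. diffs c n * t ^ n)) (at t)"
      by (rule termdiffs_strong_converges_everywhere) (use inner_flow(2) in \<open>simp add: c_def\<close>)
    ultimately show ?thesis
      by (simp add: c_def inner_flow(1))
  qed
  have "L (flow L t v) = flow L t (L v)"
    unfolding flow_def
    using bounded_linear.suminf[OF bl flow_summable[OF assms, of t v]]
    by (simp add: linear_scale[OF assms] funpow_swap1)
  moreover have "((\<lambda>s. flow L s v \<bullet> b) has_derivative (\<lambda>h. (h *\<^sub>R flow L t (L v)) \<bullet> b)) (at t within S)" for b
    using comp[of b] unfolding has_field_derivative_def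
    by (simp add: has_derivative_at_withinI mult_commute_abs)
  then have "((\<lambda>s. flow L s v) has_vector_derivative flow L t (L v)) (at t within S)"
    unfolding has_vector_derivative_def has_derivative_componentwise_within[where f="\<lambda>s. flow L s v"]
    by blast
  ultimately show ?thesis by simp
qed

text \<open>
  Formally \<open>|y|' \<le> |f|\<close>, because the dissipative part only decreases the norm. The norm is not
  differentiable at \<open>0\<close>, so the argument is run for \<open>sqrt (|y|\<^sup>2 + e\<^sup>2)\<close>, and \<open>e\<close> is arbitrary.
\<close>

lemma norm_forced_dissipative_le:
  fixes y :: "real \<Rightarrow> 'a::euclidean_space"
  assumes diss: "\<And>v. v \<bullet> L v \<le> 0"
    and y: "\<And>s. (y has_vector_derivative L (y s) + f s) (at s)"
    and c: "\<And>s. (c has_real_derivative c' s) (at s)"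
    and f: "\<And>s. 0 \<le> s \<Longrightarrow> norm (f s) \<le> c' s"
    and d: "0 \<le> d"
  shows "norm (y d) \<le> norm (y 0) + (c d - c 0)"
proof (rule field_le_epsilon)
  fix e :: real
  assume e: "e > 0"
  define z where "z s = sqrt (y s \<bullet> y s + e\<^sup>2)" for s
  have pos: "y s \<bullet> y s + e\<^sup>2 > 0" for s
    using e by (simp add: add_nonneg_pos)
  then have zpos: "z s > 0" for s by (simp add: z_def)
  have ley: "norm (y s) \<le> z s" for s
    unfolding z_def norm_eq_sqrt_inner by simp
  have "((\<lambda>s. y s \<bullet> y s + e\<^sup>2) has_vector_derivative 2 * (y s \<bullet> (L (y s) + f s))) (at s)" for s
    using y[of s]
    by (auto intro!: derivative_eq_intros simp: has_vector_derivative_def inner_commute algebra_simps)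
  then have sq: "((\<lambda>s. y s \<bullet> y s + e\<^sup>2) has_real_derivative 2 * (y s \<bullet> (L (y s) + f s))) (at s)" for s
    by (simp add: has_real_derivative_iff_has_vector_derivative)
  have zd: "(z has_real_derivative (y s \<bullet> (L (y s) + f s)) / z s) (at s)" for s
    unfolding z_def
    using DERIV_chain2[where f=sqrt and g="\<lambda>s. y s \<bullet> y s + e\<^sup>2" and x=s and s=UNIV,
        OF DERIV_real_sqrt[OF pos] sq]
    by (simp add: field_simps)
  have "z d - c d \<le> z 0 - c 0"
  proof (rule DERIV_nonpos_imp_nonincreasing[OF d])
    fix s assume s: "0 \<le> s" "s \<le> d"
    have "y s \<bullet> (L (y s) + f s) \<le> norm (y s) * norm (f s)"
      using diss[of "y s"] norm_cauchy_schwarz[of "y s" "f s"] by (simp add: inner_add_right)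
    also have "\<dots> \<le> z s * c' s"
      by (intro mult_mono ley f s norm_ge_zero less_imp_le[OF zpos])
    finally have "(y s \<bullet> (L (y s) + f s)) / z s - c' s \<le> 0"
      using zpos[of s] by (simp add: pos_divide_le_eq mult.commute)
    then show "\<exists>D. ((\<lambda>s. z s - c s) has_real_derivative D) (at s) \<and> D \<le> 0"
      by (intro exI conjI) (rule DERIV_diff[OF zd c])
  qed
  moreover have "z 0 \<le> norm (y 0) + e"
    unfolding z_def using sqrt_add_le_add_sqrt[of "y 0 \<bullet> y 0" "e\<^sup>2"] e
    by (simp add: norm_eq_sqrt_inner)
  ultimately show "norm (y d) \<le> norm (y 0) + (c d - c 0) + e"
    using ley[of d] by linarith
qed

lemma norm_flow_le:
  assumes "linear L" "\<And>v. v \<bullet> L v \<le> 0" "0 \<le> d"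
  shows "norm (flow L d v) \<le> norm v"
  using norm_forced_dissipative_le[where y="\<lambda>s. flow L s v" and f="\<lambda>_. 0" and c="\<lambda>_. 0"
      and c'="\<lambda>_. 0", OF assms(2) _ _ _ assms(3)] flow_has_vector_derivative[OF assms(1)]
  by simp

lemma norm_flow_diff_time_le:
  assumes L: "linear L" "\<And>v. v \<bullet> L v \<le> 0" and "0 \<le> a" "0 \<le> b"
  shows "norm (flow L a v - flow L b v) \<le> onorm L * norm v * \<bar>a - b\<bar>"
proof -
  have bl: "bounded_linear L"
    using L by (simp add: linear_conv_bounded_linear)
  have "norm (flow L a v - flow L b v) \<le> (onorm L * norm v) * norm (a - b)"
  proof (rule differentiable_bound[OF convex_real_interval(1)])
    show "((\<lambda>s. flow L s v) has_derivative (\<lambda>h. h *\<^sub>R L (flow L s v))) (at s within {0..})"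
      for s using flow_has_vector_derivative[OF L(1)] by (simp add: has_vector_derivative_def)
    fix s :: real assume "s \<in> {0..}"
    then have "norm (L (flow L s v)) \<le> onorm L * norm (flow L s v)"
      by (simp add: onorm[OF bl])
    also have "\<dots> \<le> onorm L * norm v"
      using norm_flow_le[OF L] \<open>s \<in> {0..}\<close> by (intro mult_left_mono onorm_pos_le[OF bl]) auto
    finally show "onorm (\<lambda>h. h *\<^sub>R L (flow L s v)) \<le> onorm L * norm v"
      by (intro onorm_le) (simp add: mult.commute mult_left_mono)
  qed (use assms in auto)
  then show ?thesis by simp
qed

text \<open>
  The difference solves the equation of \<open>L\<close> forced by \<open>(L - A)\<close> applied to the flow of \<open>A\<close>. Only the
  deviation \<open>\<delta>\<close> enters the bound, never the size of \<open>L\<close> itself.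
\<close>

lemma norm_flow_diff_le:
  assumes L: "linear L" "\<And>v. v \<bullet> L v \<le> 0" and A: "linear A" "\<And>v. v \<bullet> A v \<le> 0"
    and D: "\<And>v. norm (L v - A v) \<le> \<delta> * norm v" and "0 \<le> \<delta>" "0 \<le> d"
  shows "norm (flow L d v - flow A d v) \<le> d * \<delta> * norm v"
proof -
  let ?y = "\<lambda>s. flow L s v - flow A s v"
  have "norm (?y d) \<le> norm (?y 0) + (d * \<delta> * norm v - 0 * \<delta> * norm v)"
  proof (rule norm_forced_dissipative_le[OF L(2), where f="\<lambda>s. L (flow A s v) - A (flow A s v)"
      and c'="\<lambda>_. \<delta> * norm v"])
    show "(?y has_vector_derivative L (?y s) + (L (flow A s v) - A (flow A s v))) (at s)" for s
      using has_vector_derivative_diff[OF flow_has_vector_derivative[OF L(1), of v]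
          flow_has_vector_derivative[OF A(1), of v]]
      by (simp add: linear_diff[OF L(1)])
    show "norm (L (flow A s v) - A (flow A s v)) \<le> \<delta> * norm v" if "0 \<le> s" for s
      using order_trans[OF D[of "flow A s v"] mult_left_mono[OF norm_flow_le[OF A that, of v]]]
        \<open>0 \<le> \<delta>\<close> by auto
  qed (use \<open>0 \<le> d\<close> in \<open>auto intro!: derivative_eq_intros\<close>)
  then show ?thesis by simp
qed

text \<open>
  The average of the differences \<open>g\<^sub>j\<close> of the flows solves the equation of \<open>A\<close> forced by the average of
  \<open>(L\<^sub>j - A)\<close> applied to the flow of \<open>L\<^sub>j\<close>. Since the deviations average to zero, the flow of \<open>L\<^sub>j\<close> may
  be replaced by \<open>g\<^sub>j\<close> there, which is itself of order \<open>s \<delta>\<^sub>j\<close>; hence the forcing is of second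
  order in the deviation.
\<close>

lemma norm_mean_flow_diff_le:
  assumes L: "\<And>j. j \<in> I \<Longrightarrow> linear (L j)" "\<And>j v. j \<in> I \<Longrightarrow> v \<bullet> L j v \<le> 0"
    and A: "linear A" "\<And>v. v \<bullet> A v \<le> 0"
    and D: "\<And>j v. j \<in> I \<Longrightarrow> norm (L j v - A v) \<le> \<delta> j * norm v"
    and \<delta>: "\<And>j. j \<in> I \<Longrightarrow> 0 \<le> \<delta> j"
    and p: "\<And>j. j \<in> I \<Longrightarrow> 0 \<le> p j" "(\<Sum>j\<in>I. p j) = 1"
    and mean: "\<And>v. (\<Sum>j\<in>I. p j *\<^sub>R L j v) = A v"
    and "0 \<le> d"
  shows "norm (\<Sum>j\<in>I. p j *\<^sub>R (flow (L j) d v - flow A d v))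
           \<le> d\<^sup>2 / 2 * (\<Sum>j\<in>I. (\<delta> j)\<^sup>2 * p j) * norm v"
proof -
  let ?V = "\<Sum>j\<in>I. (\<delta> j)\<^sup>2 * p j"
  let ?g = "\<lambda>j s. flow (L j) s v - flow A s v"
  let ?y = "\<lambda>s. \<Sum>j\<in>I. p j *\<^sub>R ?g j s"
  let ?f = "\<lambda>s. \<Sum>j\<in>I. p j *\<^sub>R (L j (?g j s) - A (?g j s))"
  have "norm (?y d) \<le> norm (?y 0) + (d\<^sup>2 / 2 * ?V * norm v - 0\<^sup>2 / 2 * ?V * norm v)"
  proof (rule norm_forced_dissipative_le[OF A(2), where f="?f" and c'="\<lambda>s. s * ?V * norm v"])
    show "(?y has_vector_derivative A (?y s) + ?f s) (at s)" for s
    proof -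
      have "(?y has_vector_derivative (\<Sum>j\<in>I. p j *\<^sub>R (L j (flow (L j) s v) - A (flow A s v)))) (at s)"
        by (auto intro!: derivative_eq_intros flow_has_vector_derivative L A)
      \<comment> \<open>The mean-zero property: \<open>L j\<close> and \<open>A\<close> have the same average on the deterministic flow.\<close>
      moreover have "(\<Sum>j\<in>I. p j *\<^sub>R L j (flow A s v)) = (\<Sum>j\<in>I. p j *\<^sub>R A (flow A s v))"
        by (simp add: mean p(2) flip: scaleR_left.sum)
      ultimately show ?thesis
        by (simp add: linear_sum[OF A(1)] linear_scale[OF A(1)] linear_diff L A(1) scaleR_diff_right
            sum_subtractf)
    qed
    show "norm (?f s) \<le> s * ?V * norm v" if s: "0 \<le> s" for s
    proof -
      have "norm (?f s) \<le> (\<Sum>j\<in>I. p j * (\<delta> j * (s * \<delta> j * norm v)))"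
      proof (rule sum_norm_le)
        fix j assume j: "j \<in> I"
        have "norm (L j (?g j s) - A (?g j s)) \<le> \<delta> j * norm (?g j s)"
          by (rule D[OF j])
        also have "\<dots> \<le> \<delta> j * (s * \<delta> j * norm v)"
          by (intro mult_left_mono norm_flow_diff_le L A D \<delta> j s)
        finally show "norm (p j *\<^sub>R (L j (?g j s) - A (?g j s))) \<le> p j * (\<delta> j * (s * \<delta> j * norm v))"
          using p(1)[OF j] by (simp add: mult_left_mono)
      qed
      also have "\<dots> = s * ?V * norm v"
        by (simp add: sum_distrib_left sum_distrib_right power2_eq_square ac_simps)
      finally show ?thesis .
    qed
  qed (use \<open>0 \<le> d\<close> in \<open>auto intro!: derivative_eq_intros\<close>)
  then show ?thesis by simp
qed

section \<open>Compositions of random flows\<close>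

text \<open>
  The flow of \<open>L K\<close> acts first, as suits an equation solved backwards in time from the last cell. The
  recursion then exposes the innermost factor, which acts on a deterministic vector.
\<close>

primrec evolve ::
  "(nat \<Rightarrow> 'a::euclidean_space \<Rightarrow> 'a) \<Rightarrow> (nat \<Rightarrow> real) \<Rightarrow> nat \<Rightarrow> 'a \<Rightarrow> 'a" where
  "evolve L d 0 v = v"
| "evolve L d (Suc K) v = evolve L d K (flow (L (Suc K)) (d (Suc K)) v)"

lemma linear_evolve:
  assumes "\<And>k. k \<in> {1..K} \<Longrightarrow> linear (L k)"
  shows "linear (evolve L d K)"
  using assms
proof (induction K)
  case 0
  show ?case by (rule linearI) auto
next
  case (Suc K)
  have "linear (evolve L d K \<circ> flow (L (Suc K)) (d (Suc K)))"
    by (intro linear_compose Suc.IH linear_flow Suc.prems) auto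
  then show ?case by (simp add: o_def)
qed

lemma norm_evolve_le:
  assumes "\<And>k. k \<in> {1..K} \<Longrightarrow> linear (L k)" "\<And>k v. k \<in> {1..K} \<Longrightarrow> v \<bullet> L k v \<le> 0"
    and "\<And>k. k \<in> {1..K} \<Longrightarrow> 0 \<le> d k"
  shows "norm (evolve L d K v) \<le> norm v"
  using assms
proof (induction K arbitrary: v)
  case (Suc K)
  have "norm (evolve L d (Suc K) v) \<le> norm (flow (L (Suc K)) (d (Suc K)) v)"
    using Suc.IH Suc.prems by simp
  also have "\<dots> \<le> norm v"
    using Suc.prems by (intro norm_flow_le) auto
  finally show ?case .
qed simp

lemma evolve_cong:
  assumes "\<And>k. k \<in> {1..K} \<Longrightarrow> L k = L' k" "\<And>k. k \<in> {1..K} \<Longrightarrow> d k = d' k"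
  shows "evolve L d K v = evolve L' d' K v"
  using assms by (induction K arbitrary: v) auto

text \<open>
  Independence of the draws: the last index can be averaged out with the others held fixed.
\<close>

lemma expect_Suc:
  "expect M p (Suc K) X = expect M p K (\<lambda>\<sigma>. (\<Sum>j = 1..2^M. p j * X (\<sigma>(Suc K := j))))"
proof -
  let ?\<Phi> = "\<lambda>(j, \<sigma>). \<sigma>(Suc K := j)"
  have space: "sample_space M (Suc K) = ?\<Phi> ` ({1..2^M} \<times> sample_space M K)"
    unfolding sample_space_def by (simp add: atLeastAtMostSuc_conv PiE_insert_eq)
  have inj: "inj_on ?\<Phi> ({1..2^M} \<times> sample_space M K)"
    unfolding sample_space_def by (rule inj_combinator) simp
  have prod: "(\<Prod>k = 1..Suc K. p ((\<sigma>(Suc K := j)) k)) = p j * (\<Prod>k = 1..K. p (\<sigma> k))" for \<sigma> j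
    by simp
  have "expect M p (Suc K) X
      = (\<Sum>(j, \<sigma>)\<in>{1..2^M} \<times> sample_space M K. X (\<sigma>(Suc K := j)) * (p j * (\<Prod>k = 1..K. p (\<sigma> k))))"
    unfolding expect_def space sum.reindex[OF inj] by (simp add: case_prod_beta mult.commute)
  also have "\<dots> = (\<Sum>j = 1..2^M. \<Sum>\<sigma>\<in>sample_space M K. X (\<sigma>(Suc K := j)) * (p j * (\<Prod>k = 1..K. p (\<sigma> k))))"
    by (simp add: sum.cartesian_product)
  also have "\<dots> = expect M p K (\<lambda>\<sigma>. (\<Sum>j = 1..2^M. p j * X (\<sigma>(Suc K := j))))"
    unfolding expect_def by (subst sum.swap) (simp add: sum_distrib_left sum_distrib_right ac_simps)
  finally show ?thesis .
qed

lemma expect_const: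
  assumes "(\<Sum>j = 1..2^M. p j) = 1"
  shows "expect M p K (\<lambda>_. c) = c"
  using assms
  by (induction K) (simp_all add: expect_Suc expect_def[of _ _ 0] sample_space_def flip: sum_distrib_right)

lemma expect_add: "expect M p K (\<lambda>\<sigma>. X \<sigma> + Y \<sigma>) = expect M p K X + expect M p K Y"
  by (simp add: expect_def sum.distrib distrib_right)

lemma expect_cmult: "expect M p K (\<lambda>\<sigma>. c * X \<sigma>) = c * expect M p K X"
  by (simp add: expect_def sum_distrib_left ac_simps)

lemma expect_sum: "expect M p K (\<lambda>\<sigma>. \<Sum>i\<in>I. X i \<sigma>) = (\<Sum>i\<in>I. expect M p K (X i))"
  unfolding expect_def by (subst sum.swap) (simp add: sum_distrib_right)

lemma expect_mono:
  assumes "\<And>j. j \<in> {1..2^M} \<Longrightarrow> 0 \<le> p j"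
    and "\<And>\<sigma>. \<sigma> \<in> sample_space M K \<Longrightarrow> X \<sigma> \<le> Y \<sigma>"
  shows "expect M p K X \<le> expect M p K Y"
  unfolding expect_def using assms
  by (intro sum_mono mult_right_mono prod_nonneg) (auto simp: sample_space_def PiE_def Pi_def)

text \<open>
  Induction on the number of cells, for all \<open>v\<close> at once. Replacing the innermost random flow by the
  flow of \<open>A\<close> splits the error into \<open>E(g\<^sub>j)\<close>, where \<open>g\<^sub>j\<close> is the one-cell error and \<open>E\<close> the contraction
  formed by the other cells, and \<open>Y\<close>, the error of the other cells. Since \<open>E\<close> is linear and neither
  \<open>E\<close> nor \<open>Y\<close> depends on the last index, averaging the cross term over that index only meets the mean
  of \<open>g\<^sub>j\<close>. The square contributes \<open>d\<^sup>2 V\<close> and twice the cross term \<open>2 d\<^sup>2 V\<close>, which explains the \<open>3\<close>.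
\<close>

lemma expect_evolve_diff_le:
  fixes L :: "nat \<Rightarrow> 'a::euclidean_space \<Rightarrow> 'a" and A :: "'a \<Rightarrow> 'a"
  assumes L: "\<And>j. j \<in> {1..2^M} \<Longrightarrow> linear (L j)" "\<And>j v. j \<in> {1..2^M} \<Longrightarrow> v \<bullet> L j v \<le> 0"
    and A: "linear A" "\<And>v. v \<bullet> A v \<le> 0"
    and D: "\<And>j v. j \<in> {1..2^M} \<Longrightarrow> norm (L j v - A v) \<le> \<delta> j * norm v"
    and \<delta>: "\<And>j. j \<in> {1..2^M} \<Longrightarrow> 0 \<le> \<delta> j"
    and p: "\<And>j. j \<in> {1..2^M} \<Longrightarrow> 0 \<le> p j" "(\<Sum>j = 1..2^M. p j) = 1"
    and mean: "\<And>v. (\<Sum>j = 1..2^M. p j *\<^sub>R L j v) = A v"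
    and d: "\<And>k. k \<in> {1..K} \<Longrightarrow> 0 \<le> d k"
  defines "V \<equiv> \<Sum>j = 1..2^M. (\<delta> j)\<^sup>2 * p j"
  shows "expect M p K (\<lambda>\<sigma>. (norm (evolve (\<lambda>k. L (\<sigma> k)) d K v - evolve (\<lambda>_. A) d K v))\<^sup>2)
           \<le> 3 * V * (norm v)\<^sup>2 * (\<Sum>k = 1..K. (d k)\<^sup>2)"
  using d
proof (induction K arbitrary: v)
  case 0
  show ?case by (simp add: expect_def sample_space_def)
next
  case (Suc K)
  let ?r = "d (Suc K)"
  let ?w = "flow A ?r v"
  let ?g = "\<lambda>j. flow (L j) ?r v - ?w"
  let ?E = "\<lambda>\<sigma>. evolve (\<lambda>k. L (\<sigma> k)) d K"
  let ?Y = "\<lambda>\<sigma>. ?E \<sigma> ?w - evolve (\<lambda>_. A) d K ?w"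
  have r: "0 \<le> ?r" using Suc.prems by simp
  have V: "0 \<le> V" unfolding V_def by (intro sum_nonneg) (auto simp: p)
  have w: "norm ?w \<le> norm v" by (rule norm_flow_le[OF A r])
  have step: "(\<Sum>j = 1..2^M. p j * (norm (evolve (\<lambda>k. L ((\<sigma>(Suc K := j)) k)) d (Suc K) v
        - evolve (\<lambda>_. A) d (Suc K) v))\<^sup>2) \<le> (norm (?Y \<sigma>))\<^sup>2 + 3 * V * (norm v)\<^sup>2 * ?r\<^sup>2"
    if \<sigma>: "\<sigma> \<in> sample_space M K" for \<sigma>
  proof -
    have mem: "\<sigma> k \<in> {1..2^M}" if "k \<in> {1..K}" for k
      using \<sigma> that unfolding sample_space_def by blast
    have linE: "linear (?E \<sigma>)"
      by (intro linear_evolve L mem)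
    have contr: "norm (?E \<sigma> z) \<le> norm z" for z
      using Suc.prems by (intro norm_evolve_le L mem) auto
    have split: "evolve (\<lambda>k. L ((\<sigma>(Suc K := j)) k)) d (Suc K) v - evolve (\<lambda>_. A) d (Suc K) v
        = ?E \<sigma> (?g j) + ?Y \<sigma>" for j
    proof -
      have "evolve (\<lambda>k. L ((\<sigma>(Suc K := j)) k)) d K z = ?E \<sigma> z" for z
        by (rule evolve_cong) auto
      then show ?thesis
        by (simp add: linear_diff[OF linE])
    qed
    have square: "(\<Sum>j = 1..2^M. p j * (norm (?E \<sigma> (?g j)))\<^sup>2) \<le> V * (norm v)\<^sup>2 * ?r\<^sup>2"
    proof -
      have "p j * (norm (?E \<sigma> (?g j)))\<^sup>2 \<le> p j * (?r * \<delta> j * norm v)\<^sup>2" if j: "j \<in> {1..2^M}" for j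
        by (intro mult_left_mono power_mono p j norm_ge_zero
            order_trans[OF contr norm_flow_diff_le[OF L A D \<delta> r]])
      then have "(\<Sum>j = 1..2^M. p j * (norm (?E \<sigma> (?g j)))\<^sup>2)
          \<le> (\<Sum>j = 1..2^M. p j * (?r * \<delta> j * norm v)\<^sup>2)"
        by (rule sum_mono)
      also have "\<dots> = V * (norm v)\<^sup>2 * ?r\<^sup>2"
        unfolding V_def by (simp add: sum_distrib_left sum_distrib_right power_mult_distrib ac_simps)
      finally show ?thesis .
    qed
    have cross: "(\<Sum>j = 1..2^M. p j * (?E \<sigma> (?g j) \<bullet> ?Y \<sigma>)) \<le> V * (norm v)\<^sup>2 * ?r\<^sup>2"
    proof -
      have "(\<Sum>j = 1..2^M. p j * (?E \<sigma> (?g j) \<bullet> ?Y \<sigma>)) = ?E \<sigma> (\<Sum>j = 1..2^M. p j *\<^sub>R ?g j) \<bullet> ?Y \<sigma>"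
        by (simp add: linear_sum[OF linE] linear_scale[OF linE] inner_sum_left)
      also have "\<dots> \<le> norm (?E \<sigma> (\<Sum>j = 1..2^M. p j *\<^sub>R ?g j)) * norm (?Y \<sigma>)"
        by (rule norm_cauchy_schwarz)
      also have "\<dots> \<le> (?r\<^sup>2 / 2 * V * norm v) * (2 * norm v)"
      proof (rule mult_mono)
        show "norm (?E \<sigma> (\<Sum>j = 1..2^M. p j *\<^sub>R ?g j)) \<le> ?r\<^sup>2 / 2 * V * norm v"
          unfolding V_def
          by (rule order_trans[OF contr norm_mean_flow_diff_le[OF L A D \<delta> p mean r]])
        have "norm (?Y \<sigma>) \<le> norm (?E \<sigma> ?w) + norm (evolve (\<lambda>_. A) d K ?w)"
          by (rule norm_triangle_ineq4)
        also have "norm (evolve (\<lambda>_. A) d K ?w) \<le> norm ?w"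
          using Suc.prems by (intro norm_evolve_le A) auto
        finally show "norm (?Y \<sigma>) \<le> 2 * norm v"
          using contr[of ?w] w by linarith
      qed (use V in auto)
      also have "\<dots> = V * (norm v)\<^sup>2 * ?r\<^sup>2"
        by (simp add: power2_eq_square)
      finally show ?thesis .
    qed
    have expand: "p j * (norm (?E \<sigma> (?g j) + ?Y \<sigma>))\<^sup>2 = p j * (norm (?E \<sigma> (?g j)))\<^sup>2
        + 2 * (p j * (?E \<sigma> (?g j) \<bullet> ?Y \<sigma>)) + p j * (norm (?Y \<sigma>))\<^sup>2" for j
      unfolding power2_norm_eq_inner by (simp add: inner_add inner_commute algebra_simps)
    have "(\<Sum>j = 1..2^M. p j * (norm (?E \<sigma> (?g j) + ?Y \<sigma>))\<^sup>2)
      = (\<Sum>j = 1..2^M. p j * (norm (?E \<sigma> (?g j)))\<^sup>2)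
        + 2 * (\<Sum>j = 1..2^M. p j * (?E \<sigma> (?g j) \<bullet> ?Y \<sigma>)) + (norm (?Y \<sigma>))\<^sup>2"
      unfolding expand sum.distrib using p(2) by (simp flip: sum_distrib_left sum_distrib_right)
    with square cross show ?thesis
      unfolding split by linarith
  qed
  have "expect M p (Suc K) (\<lambda>\<sigma>. (norm (evolve (\<lambda>k. L (\<sigma> k)) d (Suc K) v - evolve (\<lambda>_. A) d (Suc K) v))\<^sup>2)
      \<le> expect M p K (\<lambda>\<sigma>. (norm (?Y \<sigma>))\<^sup>2 + 3 * V * (norm v)\<^sup>2 * ?r\<^sup>2)"
    unfolding expect_Suc by (intro expect_mono p step)
  also have "\<dots> = expect M p K (\<lambda>\<sigma>. (norm (?Y \<sigma>))\<^sup>2) + 3 * V * (norm v)\<^sup>2 * ?r\<^sup>2"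
    by (simp add: expect_add expect_const[OF p(2)])
  also have "\<dots> \<le> 3 * V * (norm ?w)\<^sup>2 * (\<Sum>k = 1..K. (d k)\<^sup>2) + 3 * V * (norm v)\<^sup>2 * ?r\<^sup>2"
    using Suc by (intro add_mono) auto
  also have "\<dots> \<le> 3 * V * (norm v)\<^sup>2 * (\<Sum>k = 1..K. (d k)\<^sup>2) + 3 * V * (norm v)\<^sup>2 * ?r\<^sup>2"
    using w V by (intro add_mono mult_right_mono mult_left_mono power_mono sum_nonneg) auto
  finally show ?case
    by (simp add: distrib_left)
qed

section \<open>Absolutely continuous functions and integrals\<close>

lemma abs_continuous_on_intervalE:
  assumes "abs_continuous_on_interval a b f" "\<epsilon> > 0"
  obtains \<delta> where "\<delta> > 0" "\<forall>(n::nat) l r. (\<forall>i<n. a \<le> l i \<and> l i \<le> r i \<and> r i \<le> b) \<longrightarrow>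
    disjoint_family_on (\<lambda>i. {l i<..<r i}) {..<n} \<longrightarrow> (\<Sum>i<n. r i - l i) < \<delta> \<longrightarrow>
    (\<Sum>i<n. dist (f (l i)) (f (r i))) < \<epsilon>"
proof -
  obtain \<delta> where "\<delta> > 0" and \<delta>: "\<forall>(n::nat) l r.
        (\<forall>i<n. a \<le> l i \<and> l i \<le> r i \<and> r i \<le> b) \<and>
        disjoint_family_on (\<lambda>i. {l i<..<r i}) {..<n} \<and> (\<Sum>i<n. r i - l i) < \<delta>
        \<longrightarrow> (\<Sum>i<n. dist (f (l i)) (f (r i))) < \<epsilon>"
    using assms(1)[unfolded abs_continuous_on_interval_def, rule_format, OF assms(2)]
    by (elim exE conjE)
  show thesis
    by (rule that[OF \<open>\<delta> > 0\<close>], intro allI impI)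
       (rule \<delta>[THEN spec, THEN spec, THEN spec, THEN mp], intro conjI)
qed

text \<open>
  The fundamental theorem of calculus for absolutely continuous functions. The derivative is only
  known off a null set \<open>N\<close>, on which the integrand may be taken to be \<open>0\<close>. In the gauge integral the
  intervals tagged in \<open>N\<close> can be forced into an open set of small measure, so absolute continuity makes
  their total increment of \<open>f\<close> small; the others are handled as in the classical case. Integrability of
  the derivative is a conclusion.
\<close>

lemma has_integral_abs_continuous_derivative:
  fixes f :: "real \<Rightarrow> 'a::banach"
  assumes "a \<le> b" and ac: "abs_continuous_on_interval a b f"
    and deriv: "AE t in lebesgue_on {a..b}. (f has_vector_derivative g t) (at t within {a..b})"
  shows "(g has_integral f b - f a) {a..b}"
proof (cases "a = b")
  case False
  with \<open>a \<le> b\<close> have "a < b" by simp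
  define N where "N = {t \<in> {a..b}. \<not> (f has_vector_derivative g t) (at t within {a..b})}"
  define g0 where "g0 t = (if t \<in> N then 0 else g t)" for t
  have "AE t in lebesgue. t \<in> {a..b} \<longrightarrow> (f has_vector_derivative g t) (at t within {a..b})"
    using deriv by (subst (asm) AE_restrict_space_iff) auto
  then obtain Z where "Z \<in> null_sets lebesgue" "N \<subseteq> Z"
    unfolding eventually_ae_filter N_def by auto
  then have neg: "negligible N"
    using negligible_iff_null_sets negligible_subset by blast
  have "(g0 has_integral f b - f a) {a..b}"
    unfolding has_integral_factor_content_real
  proof (intro allI impI)
    fix e :: real assume e: "e > 0"
    then have "e / 2 * (b - a) > 0" using \<open>a < b\<close> by simp
    obtain \<delta> where "\<delta> > 0" and \<delta>: "\<forall>(n::nat) l r.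
        (\<forall>i<n. a \<le> l i \<and> l i \<le> r i \<and> r i \<le> b) \<longrightarrow>
        disjoint_family_on (\<lambda>i. {l i<..<r i}) {..<n} \<longrightarrow> (\<Sum>i<n. r i - l i) < \<delta> \<longrightarrow>
        (\<Sum>i<n. dist (f (l i)) (f (r i))) < e / 2 * (b - a)"
    by (rule abs_continuous_on_intervalE[OF ac \<open>e / 2 * (b - a) > 0\<close>])
    obtain G where G: "open G" "N \<subseteq> G" "G \<in> lmeasurable" "measure lebesgue G < \<delta>"
    proof -
      have N: "N \<in> null_sets lebesgue"
        using neg negligible_iff_null_sets by blast
      then obtain G where G: "open G" "N \<subseteq> G" "G - N \<in> lmeasurable" "emeasure lebesgue (G - N) < ennreal \<delta>"
        using sets_lebesgue_outer_open[of N \<delta>] \<open>\<delta> > 0\<close> by blast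
      have "emeasure lebesgue G = emeasure lebesgue ((G - N) \<union> N)"
        using G(2) by (simp add: Un_absorb2)
      also have "\<dots> = emeasure lebesgue (G - N)"
        using G(3) N by (intro emeasure_Un_null_set) auto
      finally have em: "emeasure lebesgue G < ennreal \<delta>"
        using G(4) by simp
      have Gm: "G \<in> lmeasurable"
        using G(1) em by (intro fmeasurableI) (auto intro: order_less_trans)
      have "measure lebesgue G < \<delta>"
        using em \<open>\<delta> > 0\<close> emeasure_eq_measure2[OF Gm] by (simp add: ennreal_less_iff)
      with that G Gm show ?thesis by blast
    qed
    have "\<forall>x. \<exists>d>0. x \<in> {a..b} - N \<longrightarrow>
         (\<forall>y\<in>{a..b}. norm (y-x) < d \<longrightarrow> norm (f y - f x - (y-x) *\<^sub>R g x) \<le> e / 2 * norm (y-x))"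
    proof
      fix x
      show "\<exists>d>0. x \<in> {a..b} - N \<longrightarrow>
         (\<forall>y\<in>{a..b}. norm (y-x) < d \<longrightarrow> norm (f y - f x - (y-x) *\<^sub>R g x) \<le> e / 2 * norm (y-x))"
      proof (cases "x \<in> {a..b} - N")
        case True
        then have "(f has_vector_derivative g x) (at x within {a..b})"
          by (auto simp: N_def)
        then show ?thesis
          using half_gt_zero[OF e] unfolding has_vector_derivative_def has_derivative_within_alt by blast
      qed (auto intro!: exI[of _ 1])
    qed
    from choice[OF this] obtain d where "\<forall>x. 0 < d x \<and> (x \<in> {a..b} - N \<longrightarrow>
         (\<forall>y\<in>{a..b}. norm (y-x) < d x \<longrightarrow> norm (f y - f x - (y-x) *\<^sub>R g x) \<le> e / 2 * norm (y-x)))"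
      by (elim exE)
    then have d: "\<And>x. 0 < d x"
      "\<And>x y. \<lbrakk>x \<in> {a..b} - N; y \<in> {a..b}; norm (y-x) < d x\<rbrakk>
         \<Longrightarrow> norm (f y - f x - (y-x) *\<^sub>R g x) \<le> e / 2 * norm (y-x)"
      by blast+
    define \<gamma> where "\<gamma> x = (if x \<in> N then G else ball x (d x))" for x
    have gauge: "gauge \<gamma>"
      using G d(1) by (auto simp: gauge_def \<gamma>_def)
    have small: "norm ((\<Sum>(x, K)\<in>p. measure lborel K *\<^sub>R g0 x) - (f b - f a)) \<le> e * measure lborel {a..b}"
      if p: "p tagged_division_of {a..b}" and fine: "\<gamma> fine p" for p
    proof -
      have finp: "finite p" using p by blast
      have box: "\<exists>u v. u \<le> v \<and> K = {u..v} \<and> x \<in> K \<and> a \<le> u \<and> v \<le> b \<and> Inf K = u \<and> Sup K = v \<and> measure lborel K = v - u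
          \<and> interior K = {u<..<v}"
        if xK: "(x, K) \<in> p" for x K
      proof -
        obtain u v where K: "K = {u..v}" using tagged_division_ofD(4)[OF p xK] by auto
        moreover have "x \<in> K" "K \<subseteq> {a..b}" using tagged_division_ofD(2,3)[OF p xK] by auto
        ultimately show ?thesis
          by (intro exI[of _ u] exI[of _ v]) auto
      qed
      define T where "T = (\<lambda>(x, K). measure lborel K *\<^sub>R g0 x - (f (Sup K) - f (Inf K)))"
      define pN where "pN = {q \<in> p. fst q \<in> N}"
      have pN: "finite pN" "pN \<subseteq> p" using finp by (auto simp: pN_def)
      have "(\<Sum>(x, K)\<in>p. measure lborel K *\<^sub>R g0 x) - (f b - f a) = sum T p"
        using additive_tagged_division_1[OF \<open>a \<le> b\<close> p, of f]
        by (simp add: T_def split_def sum_subtractf)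
      also have "\<dots> = sum T pN + sum T (p - pN)"
        using sum.subset_diff[OF pN(2) finp, of T] by (simp add: add.commute)
      finally have "norm ((\<Sum>(x, K)\<in>p. measure lborel K *\<^sub>R g0 x) - (f b - f a)) \<le> norm (sum T pN) + norm (sum T (p - pN))"
        by (simp add: norm_triangle_ineq)
      moreover have "norm (sum T pN) \<le> e / 2 * (b - a)"
      proof -
        obtain h where h: "bij_betw h {0..<card pN} pN"
          using ex_bij_betw_nat_finite[OF pN(1)] by blast
        define n where "n = card pN"
        have h: "bij_betw h {..<n} pN" using h by (simp add: n_def atLeast0LessThan)
        define l where "l i = Inf (snd (h i))" for i
        define r where "r i = Sup (snd (h i))" for i
        have hp: "h i \<in> p" "fst (h i) \<in> N" if "i < n" for i
          using bij_betwE[OF h] that by (auto simp: pN_def)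
        have li: "a \<le> l i" "l i \<le> r i" "r i \<le> b" "{l i<..<r i} = interior (snd (h i))" "snd (h i) = {l i..r i}"
          if "i < n" for i
        proof -
          have "(fst (h i), snd (h i)) \<in> p" using hp(1)[OF that] by simp
          from box[OF this] show "a \<le> l i" "l i \<le> r i" "r i \<le> b" "{l i<..<r i} = interior (snd (h i))"
            "snd (h i) = {l i..r i}"
            unfolding l_def r_def by fastforce+
        qed
        have disj: "disjoint_family_on (\<lambda>i. {l i<..<r i}) {..<n}"
          unfolding disjoint_family_on_def
        proof (intro ballI impI)
          fix i j assume ij: "i \<in> {..<n}" "j \<in> {..<n}" "i \<noteq> j"
          then have "h i \<noteq> h j" using h by (auto simp: bij_betw_def inj_on_def)
          then have "interior (snd (h i)) \<inter> interior (snd (h j)) = {}"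
            using tagged_division_ofD(5)[OF p, of "fst (h i)" "snd (h i)" "fst (h j)" "snd (h j)"]
              hp(1)[of i] hp(1)[of j] ij by (simp add: prod_eq_iff)
          then show "{l i<..<r i} \<inter> {l j<..<r j} = {}"
            using ij by (simp only: li(4) lessThan_iff)
        qed
        have "(\<Sum>i<n. r i - l i) = measure lebesgue (\<Union>i<n. {l i<..<r i})"
          using disj li(2) by (subst measure_finite_Union) auto
        also have "\<dots> \<le> measure lebesgue G"
        proof (intro measure_mono_fmeasurable G)
          have "{l i<..<r i} \<subseteq> G" if "i < n" for i
          proof -
            have "snd (h i) \<subseteq> \<gamma> (fst (h i))"
              using fineD[OF fine, of "fst (h i)" "snd (h i)"] hp(1)[OF that] by simp
            then show ?thesis using hp(2)[OF that] li(5)[OF that] by (auto simp: \<gamma>_def)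
          qed
          then show "(\<Union>i<n. {l i<..<r i}) \<subseteq> G" by blast
        qed auto
        also note G(4)
        finally have small: "(\<Sum>i<n. r i - l i) < \<delta>" .
        have "norm (sum T pN) = norm (\<Sum>i<n. T (h i))"
          using sum.reindex_bij_betw[OF h, of T] by simp
        also have "\<dots> \<le> (\<Sum>i<n. dist (f (l i)) (f (r i)))"
        proof (rule sum_norm_le)
          fix i assume "i \<in> {..<n}"
          then have "T (h i) = f (l i) - f (r i)"
            using hp[of i] by (simp add: T_def split_def g0_def l_def r_def)
          then show "norm (T (h i)) \<le> dist (f (l i)) (f (r i))"
            by (simp add: dist_norm)
        qed
        also have "\<dots> < e / 2 * (b - a)"
          by (rule \<delta>[rule_format]) (use li disj small in auto)
        finally show ?thesis by simp
      qed
      moreover have "norm (sum T (p - pN)) \<le> e / 2 * (b - a)"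
      proof -
        have "norm (sum T (p - pN)) \<le> (\<Sum>(x, K)\<in>p - pN. e / 2 * (Sup K - Inf K))"
        proof (rule sum_norm_le, clarify)
          fix x K assume xK: "(x, K) \<in> p" "(x, K) \<notin> pN"
          obtain u v where uv: "u \<le> v" "K = {u..v}" "x \<in> K" "a \<le> u" "v \<le> b" "Inf K = u" "Sup K = v"
            "measure lborel K = v - u" using box[OF xK(1)] by blast
          have x: "x \<in> {a..b} - N" using xK uv by (auto simp: pN_def)
          have "K \<subseteq> ball x (d x)" using fine xK(1) x unfolding fine_def \<gamma>_def by fastforce
          moreover have "u \<in> K" "v \<in> K" using uv by auto
          ultimately have "u \<in> ball x (d x)" "v \<in> ball x (d x)" by blast+
          then have "norm (u - x) < d x" "norm (v - x) < d x"
            by (auto simp: dist_real_def)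
          then have bounds: "norm (f u - f x - (u - x) *\<^sub>R g x) \<le> e / 2 * norm (u - x)"
            "norm (f v - f x - (v - x) *\<^sub>R g x) \<le> e / 2 * norm (v - x)"
            using uv x by (intro d(2); simp)+
          have "T (x, K) = (f u - f x - (u - x) *\<^sub>R g x) - (f v - f x - (v - x) *\<^sub>R g x)"
            using uv x by (simp add: T_def g0_def algebra_simps)
          then have "norm (T (x, K))
              \<le> norm (f u - f x - (u - x) *\<^sub>R g x) + norm (f v - f x - (v - x) *\<^sub>R g x)"
            by (simp only: norm_triangle_ineq4)
          also have "\<dots> \<le> e / 2 * norm (u - x) + e / 2 * norm (v - x)"
            using bounds by (rule add_mono)
          also have "\<dots> = e / 2 * (v - u)"
          proof -
            have "norm (u - x) = x - u" "norm (v - x) = v - x" using uv by auto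
            then show ?thesis by (simp only:) (simp add: field_simps)
          qed
          finally show "norm (T (x, K)) \<le> e / 2 * (Sup K - Inf K)"
            using uv by simp
        qed
        also have "\<dots> \<le> (\<Sum>(x, K)\<in>p. e / 2 * (Sup K - Inf K))"
        proof (intro sum_mono2 finp)
          have "0 \<le> e / 2 * (Sup K - Inf K)" if "(x, K) \<in> p" for x K
            using box[OF that] e by auto
          then show "0 \<le> (case q of (x, K) \<Rightarrow> e / 2 * (Sup K - Inf K))" if "q \<in> p - (p - pN)" for q
            using that by (cases q) auto
        qed auto
        also have "\<dots> = e / 2 * (b - a)"
          using additive_tagged_division_1[OF \<open>a \<le> b\<close> p, of "\<lambda>x. x"]
          unfolding split_def sum_distrib_left[symmetric] by simp
        finally show ?thesis .
      qed
      ultimately show ?thesis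
        using \<open>a \<le> b\<close> by simp
    qed
    show "\<exists>\<gamma>. gauge \<gamma> \<and> (\<forall>p. p tagged_division_of {a..b} \<and> \<gamma> fine p \<longrightarrow>
        norm ((\<Sum>(x, K)\<in>p. measure lborel K *\<^sub>R g0 x) - (f b - f a)) \<le> e * measure lborel {a..b})"
      by (intro exI[of _ \<gamma>] conjI allI impI gauge) (elim conjE, rule small)
  qed
  then show ?thesis
    by (rule has_integral_spike[OF neg, rotated]) (simp add: g0_def)
qed (auto simp: has_integral_refl)

lemma abs_continuous_on_interval_subset:
  assumes "abs_continuous_on_interval a b f" "b' \<le> b"
  shows "abs_continuous_on_interval a b' f"
  unfolding abs_continuous_on_interval_def
proof (intro allI impI)
  fix \<epsilon> :: real assume "\<epsilon> > 0"
  obtain \<delta> where "\<delta> > 0" and \<delta>: "\<forall>(n::nat) l r.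
        (\<forall>i<n. a \<le> l i \<and> l i \<le> r i \<and> r i \<le> b) \<longrightarrow>
        disjoint_family_on (\<lambda>i. {l i<..<r i}) {..<n} \<longrightarrow> (\<Sum>i<n. r i - l i) < \<delta> \<longrightarrow>
        (\<Sum>i<n. dist (f (l i)) (f (r i))) < \<epsilon>"
    by (rule abs_continuous_on_intervalE[OF assms(1) \<open>\<epsilon> > 0\<close>])
  show "\<exists>\<delta>>0. \<forall>(n::nat) l r.
        (\<forall>i<n. a \<le> l i \<and> l i \<le> r i \<and> r i \<le> b') \<and>
        disjoint_family_on (\<lambda>i. {l i<..<r i}) {..<n} \<and> (\<Sum>i<n. r i - l i) < \<delta>
        \<longrightarrow> (\<Sum>i<n. dist (f (l i)) (f (r i))) < \<epsilon>"
  proof (intro exI[of _ \<delta>] conjI allI impI, goal_cases)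
    case (2 n l r)
    then show ?case using assms(2) by (intro \<delta>[rule_format]) force+
  qed fact
qed

lemma abs_continuous_on_interval_imp_continuous_on:
  assumes "abs_continuous_on_interval a b f"
  shows "continuous_on {a..b} f"
  unfolding continuous_on_iff
proof (intro ballI allI impI)
  fix x e :: real assume x: "x \<in> {a..b}" and "e > 0"
  obtain \<delta> where "\<delta> > 0" and \<delta>: "\<forall>(n::nat) l r.
        (\<forall>i<n. a \<le> l i \<and> l i \<le> r i \<and> r i \<le> b) \<longrightarrow>
        disjoint_family_on (\<lambda>i. {l i<..<r i}) {..<n} \<longrightarrow> (\<Sum>i<n. r i - l i) < \<delta> \<longrightarrow>
        (\<Sum>i<n. dist (f (l i)) (f (r i))) < e"
    by (rule abs_continuous_on_intervalE[OF assms \<open>e > 0\<close>])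
  have "dist (f y) (f x) < e" if y: "y \<in> {a..b}" "dist y x < \<delta>" for y
  proof (cases "x \<le> y")
    case True
    then show ?thesis
      using \<delta>[rule_format, of 1 "\<lambda>_. x" "\<lambda>_. y"] x y
      by (auto simp: dist_real_def dist_commute disjoint_family_on_def)
  next
    case False
    then show ?thesis
      using \<delta>[rule_format, of 1 "\<lambda>_. y" "\<lambda>_. x"] x y
      by (auto simp: dist_real_def disjoint_family_on_def)
  qed
  then show "\<exists>d>0. \<forall>x'\<in>{a..b}. dist x' x < d \<longrightarrow> dist (f x') (f x) < e"
    using \<open>\<delta> > 0\<close> by blast
qed

text \<open>
  This is what makes the fundamental theorem applicable to the pairing of a Lipschitz dual solution
  with a Caratheodory solution.
\<close>

lemma abs_continuous_on_interval_inner: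
  fixes f g :: "real \<Rightarrow> 'a::real_inner"
  assumes f: "abs_continuous_on_interval a b f"
    and lip: "\<And>s r. s \<in> {a..b} \<Longrightarrow> r \<in> {a..b} \<Longrightarrow> norm (g s - g r) \<le> L * \<bar>s - r\<bar>"
    and bound: "\<And>s. s \<in> {a..b} \<Longrightarrow> norm (g s) \<le> C"
    and "0 \<le> L" "0 \<le> C"
  shows "abs_continuous_on_interval a b (\<lambda>s. g s \<bullet> f s)"
  unfolding abs_continuous_on_interval_def
proof (intro allI impI)
  have "bounded (f ` {a..b})"
    by (intro compact_imp_bounded compact_continuous_image abs_continuous_on_interval_imp_continuous_on f) auto
  then obtain D where D: "D > 0" "\<And>s. s \<in> {a..b} \<Longrightarrow> norm (f s) \<le> D"
    by (auto simp: bounded_pos)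
  fix \<epsilon> :: real assume \<epsilon>: "\<epsilon> > 0"
  define \<epsilon>' where "\<epsilon>' = \<epsilon> / (2 * (C + 1))"
  have "\<epsilon>' > 0" using \<epsilon> \<open>0 \<le> C\<close> by (simp add: \<epsilon>'_def)
  obtain \<delta> where "\<delta> > 0" and \<delta>: "\<forall>(n::nat) l r.
        (\<forall>i<n. a \<le> l i \<and> l i \<le> r i \<and> r i \<le> b) \<longrightarrow>
        disjoint_family_on (\<lambda>i. {l i<..<r i}) {..<n} \<longrightarrow> (\<Sum>i<n. r i - l i) < \<delta> \<longrightarrow>
        (\<Sum>i<n. dist (f (l i)) (f (r i))) < \<epsilon>'"
    by (rule abs_continuous_on_intervalE[OF f \<open>\<epsilon>' > 0\<close>])
  define \<delta>' where "\<delta>' = min \<delta> (\<epsilon> / (2 * (L * D + 1)))"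
  have LD: "0 \<le> L * D" using D \<open>0 \<le> L\<close> by simp
  have pos: "\<delta>' > 0" using \<epsilon> LD \<open>\<delta> > 0\<close> by (simp add: \<delta>'_def)
  have main: "(\<Sum>i<n. dist (g (l i) \<bullet> f (l i)) (g (r i) \<bullet> f (r i))) < \<epsilon>"
    if H: "\<forall>i<n. a \<le> l i \<and> l i \<le> r i \<and> r i \<le> b"
      "disjoint_family_on (\<lambda>i. {l i<..<r i}) {..<n}" "(\<Sum>i<n. r i - l i) < \<delta>'"
    for n :: nat and l r
  proof -
    have "dist (g (l i) \<bullet> f (l i)) (g (r i) \<bullet> f (r i)) \<le> C * dist (f (l i)) (f (r i)) + L * D * (r i - l i)"
      if i: "i < n" for i
    proof -
      have mem: "l i \<in> {a..b}" "r i \<in> {a..b}" "l i \<le> r i" using H(1) i by force+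
      have "g (l i) \<bullet> f (l i) - g (r i) \<bullet> f (r i) = g (r i) \<bullet> (f (l i) - f (r i)) + (g (l i) - g (r i)) \<bullet> f (l i)"
        by (simp add: inner_diff_left inner_diff_right)
      then have "dist (g (l i) \<bullet> f (l i)) (g (r i) \<bullet> f (r i))
          \<le> norm (g (r i)) * norm (f (l i) - f (r i)) + norm (g (l i) - g (r i)) * norm (f (l i))"
        unfolding dist_real_def
        using Cauchy_Schwarz_ineq2[of "g (r i)" "f (l i) - f (r i)"]
          Cauchy_Schwarz_ineq2[of "g (l i) - g (r i)" "f (l i)"] by linarith
      also have "\<dots> \<le> C * norm (f (l i) - f (r i)) + (L * (r i - l i)) * D"
        using lip[OF mem(1,2)] mem by (intro add_mono mult_mono bound D) (auto intro: mult_nonneg_nonneg \<open>0 \<le> C\<close> \<open>0 \<le> L\<close>)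
      finally show ?thesis by (simp add: dist_norm ac_simps)
    qed
    then have "(\<Sum>i<n. dist (g (l i) \<bullet> f (l i)) (g (r i) \<bullet> f (r i)))
        \<le> (\<Sum>i<n. C * dist (f (l i)) (f (r i)) + L * D * (r i - l i))"
      by (intro sum_mono) auto
    also have "\<dots> = C * (\<Sum>i<n. dist (f (l i)) (f (r i))) + L * D * (\<Sum>i<n. r i - l i)"
      by (simp add: sum.distrib sum_distrib_left)
    also have "\<dots> \<le> C * \<epsilon>' + L * D * (\<epsilon> / (2 * (L * D + 1)))"
      using \<delta>[rule_format, of n l r] H LD \<open>0 \<le> C\<close>
      by (intro add_mono mult_left_mono) (auto simp: \<delta>'_def)
    also have "\<dots> < \<epsilon> / 2 + \<epsilon> / 2"
      using \<epsilon> LD \<open>0 \<le> C\<close>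
      by (intro add_strict_mono) (auto simp: \<epsilon>'_def divide_less_eq add_pos_nonneg algebra_simps)
    finally show ?thesis by simp
  qed
  show "\<exists>\<delta>>0. \<forall>(n::nat) l r.
        (\<forall>i<n. a \<le> l i \<and> l i \<le> r i \<and> r i \<le> b) \<and>
        disjoint_family_on (\<lambda>i. {l i<..<r i}) {..<n} \<and> (\<Sum>i<n. r i - l i) < \<delta>
        \<longrightarrow> (\<Sum>i<n. dist (g (l i) \<bullet> f (l i)) (g (r i) \<bullet> f (r i))) < \<epsilon>"
    by (intro exI[of _ \<delta>'] conjI allI impI pos) (elim conjE, rule main)
qed

text \<open>
  The discriminant argument, in the form that fits the pairing \<open>(\<psi> - \<phi>) \<bullet> B u\<close>: the product of the two
  square integrable functions enters only as a pointwise bound.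
\<close>

lemma has_integral_Cauchy_Schwarz:
  assumes f: "(f has_integral J) S"
    and \<eta>: "((\<lambda>s. (\<eta> s)\<^sup>2) has_integral a) S" and \<nu>: "((\<lambda>s. (\<nu> s)\<^sup>2) has_integral b) S"
    and bound: "\<And>s. s \<in> S \<Longrightarrow> \<bar>f s\<bar> \<le> \<eta> s * \<nu> s"
  shows "(J::real)\<^sup>2 \<le> a * b"
proof -
  have quad: "2 * l * J \<le> l\<^sup>2 * a + b" for l
  proof (rule has_integral_le)
    show "((\<lambda>s. 2 * l * f s) has_integral 2 * l * J) S"
      by (intro has_integral_mult_right f)
    show "((\<lambda>s. l\<^sup>2 * (\<eta> s)\<^sup>2 + (\<nu> s)\<^sup>2) has_integral l\<^sup>2 * a + b) S"
      by (intro has_integral_add has_integral_mult_right \<eta> \<nu>)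
    show "2 * l * f s \<le> l\<^sup>2 * (\<eta> s)\<^sup>2 + (\<nu> s)\<^sup>2" if "s \<in> S" for s
    proof -
      have "2 * l * f s \<le> 2 * \<bar>l\<bar> * \<bar>f s\<bar>"
        using abs_ge_self[of "l * f s"] by (simp add: abs_mult)
      also have "\<dots> \<le> 2 * \<bar>l\<bar> * (\<eta> s * \<nu> s)"
        using bound[OF that] by (intro mult_left_mono) auto
      also have "\<dots> \<le> l\<^sup>2 * (\<eta> s)\<^sup>2 + (\<nu> s)\<^sup>2"
        using zero_le_power2[of "\<bar>l\<bar> * \<eta> s - \<nu> s"] by (simp add: power2_diff power_mult_distrib)
      finally show ?thesis .
    qed
  qed
  have "0 \<le> a" using has_integral_nonneg[OF \<eta>] by simp
  show ?thesis
  proof (cases "a = 0")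
    case True
    have "J = 0"
    proof (rule ccontr)
      assume "J \<noteq> 0"
      \<comment> \<open>With \<open>a = 0\<close> the bound \<open>2 l J \<le> b\<close> fails for this \<open>l\<close>.\<close>
      then show False using quad[of "(b + 1) / (2 * J)"] True by simp
    qed
    then show ?thesis using True by simp
  next
    case False
    with \<open>0 \<le> a\<close> have "a > 0" by simp
    then have "J\<^sup>2 / a \<le> b"
      using quad[of "J / a"] by (simp add: power2_eq_square field_simps)
    then show ?thesis using \<open>a > 0\<close> by (simp add: field_simps)
  qed
qed

section \<open>The dual evolution on a grid\<close>

text \<open>
  The length of the \<open>k\<close>-th cell after restriction to \<open>[s, \<tau>]\<close>; a cell outside that interval has length
  \<open>0\<close> and contributes the identity to a composition of flows. Thus all evolutions from \<open>\<tau>\<close> back to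
  \<open>s\<close> are compositions of the same number \<open>K\<close> of flows.
\<close>

definition gap :: "(nat \<Rightarrow> real) \<Rightarrow> real \<Rightarrow> real \<Rightarrow> nat \<Rightarrow> real" where
  "gap t \<tau> s k = max s (min \<tau> (t k)) - max s (min \<tau> (t (k - 1)))"

lemma gap_nonneg: "t (k - 1) \<le> t k \<Longrightarrow> 0 \<le> gap t \<tau> s k"
  by (auto simp: gap_def)

lemma gap_le: "t (k - 1) \<le> t k \<Longrightarrow> gap t \<tau> s k \<le> t k - t (k - 1)"
  by (auto simp: gap_def max_def min_def)

lemma gap_lipschitz: "\<bar>gap t \<tau> s k - gap t \<tau> r k\<bar> \<le> 2 * \<bar>s - r\<bar>"
  by (auto simp: gap_def max_def min_def abs_if)

lemma sum_gap: "(\<Sum>k = 1..K. gap t \<tau> s k) = max s (min \<tau> (t K)) - max s (min \<tau> (t 0))"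
  by (induction K) (auto simp: gap_def)

lemma sum_gap_squared_le:
  assumes t: "\<And>k. k \<in> {1..K} \<Longrightarrow> t (k - 1) \<le> t k" "\<And>k. k \<in> {1..K} \<Longrightarrow> t k - t (k - 1) \<le> h"
    and "t 0 \<le> s" "s \<le> \<tau>" "\<tau> \<le> t K"
  shows "(\<Sum>k = 1..K. (gap t \<tau> s k)\<^sup>2) \<le> h * (\<tau> - s)"
proof -
  have "(\<Sum>k = 1..K. (gap t \<tau> s k)\<^sup>2) \<le> (\<Sum>k = 1..K. h * gap t \<tau> s k)"
  proof (rule sum_mono)
    fix k assume k: "k \<in> {1..K}"
    have "gap t \<tau> s k \<le> h"
      using gap_le[OF t(1)[OF k]] t(2)[OF k] by (rule order_trans)
    then show "(gap t \<tau> s k)\<^sup>2 \<le> h * gap t \<tau> s k"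
      unfolding power2_eq_square using gap_nonneg[OF t(1)[OF k]] by (rule mult_right_mono)
  qed
  also have "\<dots> = h * (\<tau> - s)"
    unfolding sum_distrib_left[symmetric] sum_gap using assms by simp
  finally show ?thesis .
qed

lemma grid_mono:
  fixes t :: "nat \<Rightarrow> real"
  assumes "\<And>k. k \<in> {1..K} \<Longrightarrow> t (k - 1) < t k" "i \<le> j" "j \<le> K"
  shows "t i \<le> t j"
  using assms(2,3)
proof (induction rule: dec_induct)
  case (step n)
  then show ?case using assms(1)[of "Suc n"] by force
qed simp

lemma grid_cell:
  fixes t :: "nat \<Rightarrow> real"
  assumes "t 0 \<le> s" "s \<le> t K" "s \<notin> t ` {..K}"
  obtains k where "k \<in> {1..K}" "t (k - 1) < s" "s < t k"
proof -
  have "\<exists>k\<in>{1..K}. t (k - 1) < s \<and> s < t k"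
    using assms
  proof (induction K)
    case (Suc K)
    show ?case
    proof (cases "s \<le> t K")
      case True
      then have "\<exists>k\<in>{1..K}. t (k - 1) < s \<and> s < t k"
        using Suc.prems by (intro Suc.IH) auto
      then show ?thesis by force
    next
      case False
      have "s \<noteq> t (Suc K)" using Suc.prems(3) by blast
      then have "s < t (Suc K)" using Suc.prems(2) by simp
      then show ?thesis using False by (intro bexI[of _ "Suc K"]) auto
    qed
  qed auto
  then show thesis using that by blast
qed

lemma evolve_zero: "(\<And>k. k \<in> {1..K} \<Longrightarrow> d k = 0) \<Longrightarrow> evolve L d K v = v"
  by (induction K arbitrary: v) auto

lemma norm_evolve_diff_time_le:
  assumes L: "\<And>k. k \<in> {1..K} \<Longrightarrow> linear (L k)" "\<And>k v. k \<in> {1..K} \<Longrightarrow> v \<bullet> L k v \<le> 0"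
    and d: "\<And>k. k \<in> {1..K} \<Longrightarrow> 0 \<le> d k" "\<And>k. k \<in> {1..K} \<Longrightarrow> 0 \<le> d' k"
  shows "norm (evolve L d K v - evolve L d' K v) \<le> (\<Sum>k = 1..K. onorm (L k) * \<bar>d k - d' k\<bar>) * norm v"
  using assms
proof (induction K arbitrary: v)
  case (Suc K)
  let ?F = "\<lambda>r. flow (L (Suc K)) r v"
  have lin: "linear (evolve L d K)"
    by (intro linear_evolve Suc.prems) auto
  have "norm (evolve L d (Suc K) v - evolve L d' (Suc K) v)
      = norm (evolve L d K (?F (d (Suc K)) - ?F (d' (Suc K)))
        + (evolve L d K (?F (d' (Suc K))) - evolve L d' K (?F (d' (Suc K)))))"
    by (simp add: linear_diff[OF lin])
  also have "\<dots> \<le> norm (?F (d (Suc K)) - ?F (d' (Suc K)))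
      + norm (evolve L d K (?F (d' (Suc K))) - evolve L d' K (?F (d' (Suc K))))"
    by (intro order_trans[OF norm_triangle_ineq] add_right_mono norm_evolve_le Suc.prems) auto
  also have "\<dots> \<le> onorm (L (Suc K)) * norm v * \<bar>d (Suc K) - d' (Suc K)\<bar>
      + (\<Sum>k = 1..K. onorm (L k) * \<bar>d k - d' k\<bar>) * norm (?F (d' (Suc K)))"
    by (intro add_mono norm_flow_diff_time_le Suc.IH Suc.prems) auto
  also have "\<dots> \<le> onorm (L (Suc K)) * norm v * \<bar>d (Suc K) - d' (Suc K)\<bar>
      + (\<Sum>k = 1..K. onorm (L k) * \<bar>d k - d' k\<bar>) * norm v"
    by (intro add_left_mono mult_left_mono norm_flow_le Suc.prems sum_nonneg mult_nonneg_nonneg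
        onorm_pos_le) (use Suc.prems in \<open>auto simp: linear_conv_bounded_linear\<close>)
  finally show ?case by (simp add: algebra_simps)
qed simp

text \<open>
  The backward equation inside a cell: for times near \<open>s\<close> in cell \<open>k\<close>, the later cells have constant
  lengths, the earlier ones have length \<open>0\<close>, and only the flow of \<open>L k\<close>, then the outermost factor,
  moves with \<open>s\<close>.
\<close>

lemma evolve_gap_has_vector_derivative:
  fixes L :: "nat \<Rightarrow> 'a::euclidean_space \<Rightarrow> 'a"
  assumes L: "\<And>k. k \<in> {1..K} \<Longrightarrow> linear (L k)"
    and t: "\<And>k. k \<in> {1..K} \<Longrightarrow> t (k - 1) < t k"
    and k: "k \<in> {1..K}" and s: "t (k - 1) < s" "s < t k" "s < \<tau>"
  shows "((\<lambda>s. evolve L (gap t \<tau> s) K v) has_vector_derivative - L k (evolve L (gap t \<tau> s) K v)) (at s)"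
  using L t k
proof (induction K arbitrary: v)
  case (Suc K)
  define I where "I = {t (k - 1)<..<min \<tau> (t k)}"
  have I: "open I" "s \<in> I" using s by (auto simp: I_def)
  show ?case
  proof (cases "k = Suc K")
    case False
    then have kK: "k \<in> {1..K}" using Suc.prems by auto
    have tk: "t k \<le> t K" "t k \<le> t (Suc K)"
      by (rule grid_mono[where t=t and K="Suc K"]; use Suc.prems(2) kK in auto)+
    define w where "w = flow (L (Suc K)) (min \<tau> (t (Suc K)) - min \<tau> (t K)) v"
    have "gap t \<tau> r (Suc K) = min \<tau> (t (Suc K)) - min \<tau> (t K)" if "r \<in> I" for r
      using that tk by (auto simp: gap_def I_def)
    then have eq: "evolve L (gap t \<tau> r) (Suc K) v = evolve L (gap t \<tau> r) K w" if "r \<in> I" for r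
      using that by (simp add: w_def)
    have "((\<lambda>s. evolve L (gap t \<tau> s) K w) has_vector_derivative - L k (evolve L (gap t \<tau> s) K w)) (at s)"
      using Suc.prems kK by (intro Suc.IH) auto
    from has_vector_derivative_transform_within_open[OF this I] eq eq[OF I(2)] show ?thesis
      by simp
  next
    case True
    define c where "c = min \<tau> (t k)"
    have eq: "evolve L (gap t \<tau> r) (Suc K) v = flow (L k) (c - r) v" if r: "r \<in> I" for r
    proof -
      have "gap t \<tau> r j = 0" if j: "j \<in> {1..K}" for j
      proof -
        have "t j \<le> t K" "t (j - 1) \<le> t K"
          by (rule grid_mono[where t=t and K="Suc K"]; use Suc.prems(2) j in auto)+
        then show ?thesis
          using r True by (auto simp: gap_def I_def max_def min_def)
      qed
      then have "evolve L (gap t \<tau> r) K w = w" for w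
        by (rule evolve_zero)
      then have "evolve L (gap t \<tau> r) (Suc K) v = flow (L k) (gap t \<tau> r k) v"
        by (simp add: True)
      also have "gap t \<tau> r k = c - r"
        using r by (auto simp: gap_def I_def c_def)
      finally show ?thesis .
    qed
    have "((\<lambda>r. c - r) has_vector_derivative -1) (at s)"
      by (auto intro!: derivative_eq_intros)
    moreover have "((\<lambda>r. flow (L k) r v) has_vector_derivative L k (flow (L k) (c - s) v)) (at (c - s))"
      using Suc.prems by (intro flow_has_vector_derivative) auto
    ultimately have "((\<lambda>r. flow (L k) (c - r) v) has_vector_derivative - L k (flow (L k) (c - s) v)) (at s)"
      using vector_diff_chain_at[of "\<lambda>r. c - r" "-1" s "\<lambda>r. flow (L k) r v"] by (simp add: o_def)
    from has_vector_derivative_transform_within_open[OF this I] eq eq[OF I(2)] show ?thesis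
      by simp
  qed
qed simp

lemma evolve_gap_lipschitz:
  assumes L: "\<And>k. k \<in> {1..K} \<Longrightarrow> linear (L k)" "\<And>k v. k \<in> {1..K} \<Longrightarrow> v \<bullet> L k v \<le> 0"
    and t: "\<And>k. k \<in> {1..K} \<Longrightarrow> t (k - 1) \<le> t k"
  obtains c where "0 \<le> c"
    "\<And>s r. norm (evolve L (gap t \<tau> s) K v - evolve L (gap t \<tau> r) K v) \<le> c * \<bar>s - r\<bar>"
proof
  let ?c = "(\<Sum>k = 1..K. onorm (L k) * 2) * norm v"
  have onn: "0 \<le> onorm (L k)" if "k \<in> {1..K}" for k
    using L(1)[OF that] by (intro onorm_pos_le) (simp add: linear_conv_bounded_linear)
  show "0 \<le> ?c"
    by (intro mult_nonneg_nonneg sum_nonneg onn) auto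
  fix s r
  have "norm (evolve L (gap t \<tau> s) K v - evolve L (gap t \<tau> r) K v)
      \<le> (\<Sum>k = 1..K. onorm (L k) * \<bar>gap t \<tau> s k - gap t \<tau> r k\<bar>) * norm v"
    by (intro norm_evolve_diff_time_le L gap_nonneg t)
  also have "\<dots> \<le> (\<Sum>k = 1..K. onorm (L k) * (2 * \<bar>s - r\<bar>)) * norm v"
    by (intro mult_right_mono sum_mono mult_left_mono gap_lipschitz onn norm_ge_zero)
  also have "\<dots> = ?c * \<bar>s - r\<bar>"
    by (simp add: sum_distrib_right sum_distrib_left ac_simps)
  finally show "norm (evolve L (gap t \<tau> s) K v - evolve L (gap t \<tau> r) K v) \<le> ?c * \<bar>s - r\<bar>" .
qed

lemma continuous_on_evolve_gap:
  assumes "\<And>k. k \<in> {1..K} \<Longrightarrow> linear (L k)" "\<And>k v. k \<in> {1..K} \<Longrightarrow> v \<bullet> L k v \<le> 0"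
    and "\<And>k. k \<in> {1..K} \<Longrightarrow> t (k - 1) \<le> t k"
  shows "continuous_on X (\<lambda>s. evolve L (gap t \<tau> s) K v)"
proof -
  obtain c where "0 \<le> c"
    "\<And>s r. norm (evolve L (gap t \<tau> s) K v - evolve L (gap t \<tau> r) K v) \<le> c * \<bar>s - r\<bar>"
    using evolve_gap_lipschitz[where L=L and K=K and t=t, OF assms] by blast
  then have "c-lipschitz_on X (\<lambda>s. evolve L (gap t \<tau> s) K v)"
    by (intro lipschitz_onI) (auto simp: dist_norm)
  then show ?thesis by (rule lipschitz_on_continuous_on)
qed

lemma AE_lebesgue_on_Icc_iff:
  "(AE s in lebesgue_on {a..b::real}. P s) \<longleftrightarrow> (AE s in lebesgue. s \<in> {a..b} \<longrightarrow> P s)"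
  by (subst AE_restrict_space_iff) auto

text \<open>
  With \<open>\<psi>\<close> the backward evolution of the adjoint maps, the two terms with \<open>L k\<close> in the derivative of
  \<open>\<psi> \<bullet> x\<close> cancel and only the forcing \<open>\<psi> \<bullet> f\<close> remains. On the finitely many grid points \<open>\<psi>\<close> may have
  kinks, but these form a null set.
\<close>

lemma evolve_gap_duality:
  fixes L L' :: "nat \<Rightarrow> 'a::euclidean_space \<Rightarrow> 'a" and x f :: "real \<Rightarrow> 'a"
  assumes L': "\<And>k. k \<in> {1..K} \<Longrightarrow> linear (L' k)" "\<And>k v. k \<in> {1..K} \<Longrightarrow> v \<bullet> L' k v \<le> 0"
    and adj: "\<And>k v w. k \<in> {1..K} \<Longrightarrow> L' k v \<bullet> w = v \<bullet> L k w"
    and t: "\<And>k. k \<in> {1..K} \<Longrightarrow> t (k - 1) < t k" "t 0 = 0" "t K = T"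
    and sol: "abs_continuous_on_interval 0 T x"
      "AE s in lebesgue_on {0..T}. (x has_vector_derivative G s (x s) + f s) (at s within {0..T})"
    and G: "\<And>k s y. k \<in> {1..K} \<Longrightarrow> t (k - 1) < s \<Longrightarrow> s < t k \<Longrightarrow> G s y = L k y"
    and \<tau>: "0 \<le> \<tau>" "\<tau> \<le> T"
  shows "((\<lambda>s. evolve L' (gap t \<tau> s) K v \<bullet> f s) has_integral
           v \<bullet> x \<tau> - evolve L' (gap t \<tau> 0) K v \<bullet> x 0) {0..\<tau>}"
proof -
  let ?\<psi> = "\<lambda>s. evolve L' (gap t \<tau> s) K v"
  have gnn: "0 \<le> gap t \<tau> s k" if "k \<in> {1..K}" for s k
    using t(1)[OF that] by (intro gap_nonneg) simp
  obtain c where "0 \<le> c" and c: "\<And>s r. norm (?\<psi> s - ?\<psi> r) \<le> c * \<bar>s - r\<bar>"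
    using evolve_gap_lipschitz[where L=L' and K=K and t=t, OF L' less_imp_le[OF t(1)]] by blast
  have "gap t \<tau> \<tau> k = 0" for k by (simp add: gap_def)
  then have end_value: "?\<psi> \<tau> = v"
    by (simp add: evolve_zero)
  have "abs_continuous_on_interval 0 \<tau> (\<lambda>s. ?\<psi> s \<bullet> x s)"
  proof (rule abs_continuous_on_interval_inner[where L="c" and C="norm v"])
    show "abs_continuous_on_interval 0 \<tau> x"
      using sol(1) \<tau>(2) by (rule abs_continuous_on_interval_subset)
    show "norm (?\<psi> s - ?\<psi> r) \<le> c * \<bar>s - r\<bar>" for s r by (rule c)
    show "norm (?\<psi> s) \<le> norm v" for s
      by (intro norm_evolve_le L' gnn)
  qed (use \<open>0 \<le> c\<close> in auto)
  moreover have "AE s in lebesgue_on {0..\<tau>}.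
      ((\<lambda>s. ?\<psi> s \<bullet> x s) has_vector_derivative ?\<psi> s \<bullet> f s) (at s within {0..\<tau>})"
  proof -
    have "finite (insert \<tau> (t ` {..K}))" by simp
    then have "insert \<tau> (t ` {..K}) \<in> null_sets lebesgue"
      using negligible_finite negligible_iff_null_sets by blast
    then have "AE s in lebesgue. s \<notin> insert \<tau> (t ` {..K})"
      by (rule AE_not_in)
    moreover have "AE s in lebesgue. s \<in> {0..T} \<longrightarrow>
        (x has_vector_derivative G s (x s) + f s) (at s within {0..T})"
      using sol(2) by (simp only: AE_lebesgue_on_Icc_iff)
    ultimately have "AE s in lebesgue. s \<in> {0..\<tau>} \<longrightarrow>
        ((\<lambda>s. ?\<psi> s \<bullet> x s) has_vector_derivative ?\<psi> s \<bullet> f s) (at s within {0..\<tau>})"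
    proof eventually_elim
      case (elim s)
      show ?case
      proof
        assume s: "s \<in> {0..\<tau>}"
        then have "t 0 \<le> s" "s \<le> t K" "s \<notin> t ` {..K}" "s < \<tau>"
          using elim \<tau> t by auto
        then obtain k where k: "k \<in> {1..K}" "t (k - 1) < s" "s < t k"
          using grid_cell by metis
        have "(?\<psi> has_vector_derivative - L' k (?\<psi> s)) (at s within {0..\<tau>})"
          using evolve_gap_has_vector_derivative[OF L'(1) t(1) k \<open>s < \<tau>\<close>]
          by (rule has_vector_derivative_at_within)
        moreover have "(x has_vector_derivative L k (x s) + f s) (at s within {0..\<tau>})"
          using elim s \<tau> by (auto simp: G[OF k] intro: has_vector_derivative_within_subset)
        ultimately have "((\<lambda>s. ?\<psi> s \<bullet> x s) has_vector_derivative
            ?\<psi> s \<bullet> (L k (x s) + f s) + - L' k (?\<psi> s) \<bullet> x s) (at s within {0..\<tau>})"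
          by (rule bounded_bilinear.has_vector_derivative[OF bounded_bilinear_inner])
        then show "((\<lambda>s. ?\<psi> s \<bullet> x s) has_vector_derivative ?\<psi> s \<bullet> f s) (at s within {0..\<tau>})"
          by (simp add: inner_add_right adj[OF k(1)])
      qed
    qed
    then show ?thesis by (simp only: AE_lebesgue_on_Icc_iff)
  qed
  ultimately have "((\<lambda>s. ?\<psi> s \<bullet> f s) has_integral ?\<psi> \<tau> \<bullet> x \<tau> - ?\<psi> 0 \<bullet> x 0) {0..\<tau>}"
    by (rule has_integral_abs_continuous_derivative[OF \<tau>(1)])
  then show ?thesis by (simp only: end_value)
qed

section \<open>Randomized splittings\<close>

lemma inner_transpose: "(transpose D *v v) \<bullet> w = v \<bullet> (D *v (w::real^'n))"
  by (simp add: transpose_matrix_vector dot_lmul_matrix)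

lemma norm_mult_vec_le_op_norm: "norm (D *v v) \<le> op_norm D * norm (v::real^'n)"
  unfolding op_norm_def by (rule onorm[OF matrix_vector_mul_bounded_linear])

lemma op_norm_nonneg: "0 \<le> op_norm (D::real^'n^'m)"
  unfolding op_norm_def by (rule onorm_pos_le[OF matrix_vector_mul_bounded_linear])

text \<open>
  The dual evolution involves transposes, whereas the variance is formed with the matrices themselves.
\<close>

lemma norm_transpose_mult_vec_le:
  fixes D :: "real^'n^'m"
  shows "norm (transpose D *v v) \<le> op_norm D * norm v"
proof (cases "norm (transpose D *v v) = 0")
  case True
  then show ?thesis by (simp only: True) (simp add: op_norm_nonneg)
next
  case False
  have "norm (transpose D *v v) * norm (transpose D *v v) = v \<bullet> (D *v (transpose D *v v))"
    by (simp only: inner_transpose[symmetric] power2_norm_eq_inner[symmetric] power2_eq_square)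
  also have "\<dots> \<le> norm v * (op_norm D * norm (transpose D *v v))"
    by (intro order_trans[OF norm_cauchy_schwarz] mult_left_mono norm_mult_vec_le_op_norm) simp
  finally show ?thesis
    using False by (simp add: mult.commute)
qed

lemma sum_scaleR_mult_vec:
  "(\<Sum>i\<in>I. c i *\<^sub>R X i) *v v = (\<Sum>i\<in>I. c i *\<^sub>R (X i *v (v::real^'n)))"
proof -
  have lin: "linear (\<lambda>X::real^'n^'m. X *v v)"
    by (rule linearI) (simp_all add: matrix_vector_mult_add_rdistrib scaleR_matrix_vector_assoc)
  show ?thesis
    by (simp add: linear_sum[OF lin] linear_scale[OF lin])
qed

lemma dissipative_random_matrix:
  assumes "\<forall>m\<in>{1..M}. \<forall>v. v \<bullet> (As m *v v) \<le> 0" "S j \<subseteq> {1..M}"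
    and "\<forall>m\<in>{1..M}. selection_prob M S p m > 0"
  shows "v \<bullet> (random_matrix M S p As j *v v) \<le> 0"
  unfolding random_matrix_def sum_scaleR_mult_vec inner_sum_right inner_scaleR_right
proof (rule sum_nonpos)
  fix m assume "m \<in> S j"
  with assms have "v \<bullet> (As m *v v) \<le> 0" "selection_prob M S p m > 0" by auto
  then show "1 / selection_prob M S p m * (v \<bullet> (As m *v v)) \<le> 0"
    by (simp add: divide_le_0_iff)
qed

text \<open>
  The weights \<open>1 / \<pi>\<^sub>m\<close> are chosen to make the random matrix an unbiased estimate of the full one.
\<close>

lemma mean_random_matrix:
  assumes "bij_betw S {1..2^M} (Pow {1..M})" "\<forall>m\<in>{1..M}. selection_prob M S p m > 0"
  shows "(\<Sum>j = 1..2^M. p j *\<^sub>R random_matrix M S p As j) = (\<Sum>m = 1..M. As m)"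
proof -
  have sub: "S j \<subseteq> {1..M}" if "j \<in> {1..2^M}" for j
    using bij_betwE[OF assms(1)] that by blast
  have "(\<Sum>j = 1..2^M. p j *\<^sub>R random_matrix M S p As j)
      = (\<Sum>j = 1..2^M. \<Sum>m = 1..M. if m \<in> S j then (p j / selection_prob M S p m) *\<^sub>R As m else 0)"
  proof (rule sum.cong)
    fix j :: nat assume "j \<in> {1..2^M}"
    then have "S j = {m \<in> {1..M}. m \<in> S j}" using sub by blast
    then have "random_matrix M S p As j = (\<Sum>m\<in>{m \<in> {1..M}. m \<in> S j}. (1 / selection_prob M S p m) *\<^sub>R As m)"
      unfolding random_matrix_def by (rule sum.cong) simp
    then have "p j *\<^sub>R random_matrix M S p As j
        = (\<Sum>m\<in>{m \<in> {1..M}. m \<in> S j}. (p j / selection_prob M S p m) *\<^sub>R As m)"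
      by (simp add: scaleR_sum_right)
    also have "\<dots> = (\<Sum>m = 1..M. if m \<in> S j then (p j / selection_prob M S p m) *\<^sub>R As m else 0)"
      by (rule sum.inter_filter) simp
    finally show "p j *\<^sub>R random_matrix M S p As j
        = (\<Sum>m = 1..M. if m \<in> S j then (p j / selection_prob M S p m) *\<^sub>R As m else 0)" .
  qed simp
  also have "\<dots> = (\<Sum>m = 1..M. \<Sum>j = 1..2^M. if m \<in> S j then (p j / selection_prob M S p m) *\<^sub>R As m else 0)"
    by (rule sum.swap)
  also have "\<dots> = (\<Sum>m = 1..M. As m)"
  proof (rule sum.cong)
    fix m assume m: "m \<in> {1..M}"
    have "(\<Sum>j = 1..2^M. if m \<in> S j then (p j / selection_prob M S p m) *\<^sub>R As m else 0)
        = (\<Sum>j | j \<in> {1..2^M} \<and> m \<in> S j. (p j / selection_prob M S p m) *\<^sub>R As m)"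
      by (rule sum.inter_filter[symmetric]) simp
    also have "\<dots> = (selection_prob M S p m / selection_prob M S p m) *\<^sub>R As m"
      unfolding scaleR_left.sum[symmetric] sum_divide_distrib[symmetric]
      by (simp only: selection_prob_def)
    also have "\<dots> = As m"
      using assms(2) m by fastforce
    finally show "(\<Sum>j = 1..2^M. if m \<in> S j then (p j / selection_prob M S p m) *\<^sub>R As m else 0) = As m" .
  qed simp
  finally show ?thesis .
qed

lemma split_matrix_on_cell:
  assumes t: "\<And>k. k \<in> {1..K} \<Longrightarrow> t (k - 1) < t k"
    and k: "k \<in> {1..K}" "t (k - 1) < s" "s < t k"
  shows "split_matrix M S p As K t \<sigma> s = random_matrix M S p As (\<sigma> k)"
proof -
  have "indicator {t (j - 1)..<t j} s *\<^sub>R random_matrix M S p As (\<sigma> j)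
      = (if j = k then random_matrix M S p As (\<sigma> j) else 0)" if j: "j \<in> {1..K}" for j
  proof (cases j k rule: linorder_cases)
    case less
    then have "t j \<le> t (k - 1)"
      using k j by (intro grid_mono[where t=t and K=K] t) auto
    then show ?thesis using less k by auto
  next
    case greater
    then have "t k \<le> t (j - 1)"
      using k j by (intro grid_mono[where t=t and K=K] t) auto
    then show ?thesis using greater k by auto
  qed (use k in auto)
  then have "split_matrix M S p As K t \<sigma> s
      = (\<Sum>j = 1..K. if j = k then random_matrix M S p As (\<sigma> j) else 0)"
    unfolding split_matrix_def by (intro sum.cong) auto
  then show ?thesis using k by simp
qed

lemma square_integrable_on_has_integral:
  assumes "square_integrable_on T u" "L2_norm T u \<le> U" "0 \<le> U" "\<tau> \<le> T"
  obtains b where "((\<lambda>s. (norm (u s))\<^sup>2) has_integral b) {0..\<tau>}" "b \<le> U\<^sup>2"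
proof -
  let ?g = "\<lambda>s. (norm (u s))\<^sup>2"
  let ?I = "\<integral>s. ?g s \<partial>lebesgue_on {0<..<T}"
  have "(?g has_integral ?I) {0<..<T}"
    using assms(1) unfolding square_integrable_on_def
    by (intro has_integral_integral_lebesgue_on) auto
  then have I: "(?g has_integral ?I) {0..T}"
    by (simp add: has_integral_Icc_iff_Ioo)
  have "sqrt ?I \<le> U" using assms(2) by (simp add: L2_norm_def)
  then have "?I \<le> U\<^sup>2" by (rule sqrt_le_D)
  have int: "?g integrable_on {0..T}" using I by blast
  have sub: "?g integrable_on {0..\<tau>}"
    using int by (rule integrable_on_subinterval) (use assms in auto)
  have "integral {0..\<tau>} ?g \<le> integral {0..T} ?g"
    using assms by (intro integral_subset_le sub int) auto
  also have "\<dots> = ?I" using I by (rule integral_unique)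
  finally show thesis
    using that[OF integrable_integral[OF sub]] \<open>?I \<le> U\<^sup>2\<close> by simp
qed

theorem mainTheorem2:
  fixes A :: "real ^ 'n ^ 'n" and B :: "real ^ 'q ^ 'n" and x0 :: "real ^ 'n"
    and T U :: real
  assumes "T > 0" and "U \<ge> 0"
  shows "\<exists>C::real.
    \<forall>(M::nat) (As :: nat \<Rightarrow> real ^ 'n ^ 'n) (S :: nat \<Rightarrow> nat set) (p :: nat \<Rightarrow> real)
     (K::nat) (t :: nat \<Rightarrow> real)
     (u :: (nat \<Rightarrow> nat) \<Rightarrow> real \<Rightarrow> real ^ 'q)
     (x :: (nat \<Rightarrow> nat) \<Rightarrow> real \<Rightarrow> real ^ 'n) (xh :: (nat \<Rightarrow> nat) \<Rightarrow> real \<Rightarrow> real ^ 'n).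
      A = (\<Sum>m = 1..M. As m) \<longrightarrow>
      (\<forall>m\<in>{1..M}. \<forall>v. v \<bullet> (As m *v v) \<le> 0) \<longrightarrow>
      bij_betw S {1..2^M} (Pow {1..M}) \<longrightarrow>
      (\<forall>\<omega>\<in>{1..2^M}. p \<omega> \<ge> 0) \<longrightarrow>
      (\<Sum>\<omega> = 1..2^M. p \<omega>) = 1 \<longrightarrow>
      (\<forall>m\<in>{1..M}. selection_prob M S p m > 0) \<longrightarrow>
      t 0 = 0 \<longrightarrow> t K = T \<longrightarrow> (\<forall>k\<in>{1..K}. t (k - 1) < t k) \<longrightarrow>
      (\<forall>\<omega>\<in>sample_space M K. square_integrable_on T (u \<omega>) \<and> L2_norm T (u \<omega>) \<le> U) \<longrightarrow>
      (\<forall>\<omega>\<in>sample_space M K.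
         solves_ivp T (\<lambda>s y. A *v y + B *v u \<omega> s) x0 (x \<omega>)) \<longrightarrow>
      (\<forall>\<omega>\<in>sample_space M K.
         solves_ivp T (\<lambda>s y. split_matrix M S p As K t \<omega> s *v y + B *v u \<omega> s) x0 (xh \<omega>)) \<longrightarrow>
      (\<forall>s\<in>{0..T}.
         expect M p K (\<lambda>\<omega>. (norm (xh \<omega> s - x \<omega> s))\<^sup>2)
           \<le> C * max_spacing K t * splitting_variance M S p As A)"
proof (intro exI allI impI ballI)
  fix M As S p K t u x xh s
  \<comment> \<open>The mean square of the dual error is at most \<open>3 V h T\<close>; splitting off the initial value by
    \<open>(a + b)\<^sup>2 \<le> 2 a\<^sup>2 + 2 b\<^sup>2\<close> doubles this, and the coordinates are summed.\<close>
  let ?C = "CARD('n) * (6 * T * ((norm x0)\<^sup>2 + (op_norm B)\<^sup>2 * U\<^sup>2 * T))"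
  assume A: "A = (\<Sum>m = 1..M. As m)"
    and diss: "\<forall>m\<in>{1..M}. \<forall>v. v \<bullet> (As m *v v) \<le> 0"
    and S: "bij_betw S {1..2^M} (Pow {1..M})"
    and p: "\<forall>\<omega>\<in>{1..2^M}. p \<omega> \<ge> 0" "(\<Sum>\<omega> = 1..2^M. p \<omega>) = 1"
    and sel: "\<forall>m\<in>{1..M}. selection_prob M S p m > 0"
    and t: "t 0 = 0" "t K = T" "\<forall>k\<in>{1..K}. t (k - 1) < t k"
    and u: "\<forall>\<omega>\<in>sample_space M K. square_integrable_on T (u \<omega>) \<and> L2_norm T (u \<omega>) \<le> U"
    and x: "\<forall>\<omega>\<in>sample_space M K. solves_ivp T (\<lambda>s y. A *v y + B *v u \<omega> s) x0 (x \<omega>)"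
    and xh: "\<forall>\<omega>\<in>sample_space M K.
         solves_ivp T (\<lambda>s y. split_matrix M S p As K t \<omega> s *v y + B *v u \<omega> s) x0 (xh \<omega>)"
    and s: "s \<in> {0..T}"
  define \<tau> where "\<tau> = s"
  have \<tau>: "0 \<le> \<tau>" "\<tau> \<le> T" using s by (auto simp: \<tau>_def)
  define R where "R = random_matrix M S p As"
  define V where "V = splitting_variance M S p As A"
  define h where "h = max_spacing K t"
  let ?R' = "\<lambda>j. (*v) (transpose (R j))"
  let ?A' = "(*v) (transpose A)"
  define \<psi> where "\<psi> \<sigma> v s = evolve (\<lambda>k. ?R' (\<sigma> k)) (gap t \<tau> s) K v" for \<sigma> v s
  define \<phi> where "\<phi> v s = evolve (\<lambda>_. ?A') (gap t \<tau> s) K v" for v s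
  have grid: "t (k - 1) < t k" "t (k - 1) \<le> t k" if "k \<in> {1..K}" for k
    using t(3) that by (auto intro: less_imp_le)
  have spacing: "t k - t (k - 1) \<le> h" if "k \<in> {1..K}" for k
    unfolding h_def max_spacing_def using that by (intro Max_ge) auto
  have h: "0 \<le> h"
  proof -
    have "K \<noteq> 0" using t(1,2) \<open>T > 0\<close> by (cases K) auto
    then show ?thesis using spacing[of 1] grid(2)[of 1] by simp
  qed
  have sub: "S j \<subseteq> {1..M}" if "j \<in> {1..2^M}" for j
    using bij_betwE[OF S] that by blast
  have R_diss: "v \<bullet> (R j *v v) \<le> 0" if "j \<in> {1..2^M}" for j v
    unfolding R_def by (rule dissipative_random_matrix[OF diss sub[OF that] sel])
  have mean: "(\<Sum>j = 1..2^M. p j *\<^sub>R (R j *v v)) = A *v v" for v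
    unfolding R_def sum_scaleR_mult_vec[symmetric] mean_random_matrix[OF S sel] A ..
  have A_diss: "v \<bullet> (A *v v) \<le> 0" for v
  proof -
    have "v \<bullet> (A *v v) = (\<Sum>j = 1..2^M. p j * (v \<bullet> (R j *v v)))"
      by (simp add: inner_sum_right flip: mean)
    also have "\<dots> \<le> 0"
      using p(1) R_diss by (intro sum_nonpos mult_nonneg_nonpos) auto
    finally show ?thesis .
  qed
  have R'_diss: "v \<bullet> ?R' j v \<le> 0" if "j \<in> {1..2^M}" for j v
    unfolding inner_commute[of v "?R' j v"] inner_transpose by (rule R_diss[OF that])
  have A'_diss: "v \<bullet> ?A' v \<le> 0" for v
    unfolding inner_commute[of v "?A' v"] inner_transpose by (rule A_diss)
  have mean': "(\<Sum>j = 1..2^M. p j *\<^sub>R ?R' j v) = ?A' v" for v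
  proof (rule vector_eq_rdot[THEN iffD1], rule allI)
    fix w
    have "(\<Sum>j = 1..2^M. p j *\<^sub>R ?R' j v) \<bullet> w = v \<bullet> (\<Sum>j = 1..2^M. p j *\<^sub>R (R j *v w))"
      unfolding inner_sum_left inner_sum_right inner_scaleR_left inner_scaleR_right inner_transpose ..
    then show "(\<Sum>j = 1..2^M. p j *\<^sub>R ?R' j v) \<bullet> w = ?A' v \<bullet> w"
      by (simp only: mean inner_transpose)
  qed
  have dev: "norm (?R' j v - ?A' v) \<le> op_norm (R j - A) * norm v" for j v
  proof -
    have "transpose (R j - A) = transpose (R j) - transpose A"
      by (simp add: transpose_def vec_eq_iff)
    then have "?R' j v - ?A' v = transpose (R j - A) *v v"
      by (simp only: matrix_vector_mult_diff_rdistrib)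
    then show ?thesis by (simp only: norm_transpose_mult_vec_le)
  qed
  have lin: "linear (\<lambda>v. v v* (X::real^'n^'n))" for X
    using matrix_vector_mul_linear[of "transpose X"] by simp
  have V: "0 \<le> V"
    unfolding V_def splitting_variance_def using p by (intro sum_nonneg) auto

  have mean_square: "expect M p K (\<lambda>\<sigma>. (norm (\<psi> \<sigma> v r - \<phi> v r))\<^sup>2) \<le> 3 * V * (h * T)"
    if r: "r \<in> {0..\<tau>}" and v: "norm v = 1" for v r
  proof -
    have "expect M p K (\<lambda>\<sigma>. (norm (\<psi> \<sigma> v r - \<phi> v r))\<^sup>2)
        \<le> 3 * V * (norm v)\<^sup>2 * (\<Sum>k = 1..K. (gap t \<tau> r k)\<^sup>2)"
      unfolding \<psi>_def \<phi>_def V_def splitting_variance_def R_def[symmetric]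
      by (rule expect_evolve_diff_le)
         (use p lin R'_diss A'_diss dev mean' op_norm_nonneg gap_nonneg grid in auto)
    also have "\<dots> \<le> 3 * V * (h * T)"
    proof -
      have "(\<Sum>k = 1..K. (gap t \<tau> r k)\<^sup>2) \<le> h * (\<tau> - r)"
        using r t \<tau> by (intro sum_gap_squared_le grid spacing) auto
      also have "\<dots> \<le> h * T" using r \<tau> h by (intro mult_left_mono) auto
      finally show ?thesis using V v by (simp add: mult_left_mono)
    qed
    finally show ?thesis .
  qed

  have cont: "continuous_on {0..\<tau>} (\<lambda>r. (norm (\<psi> \<sigma> v r - \<phi> v r))\<^sup>2)" if \<sigma>: "\<sigma> \<in> sample_space M K" for \<sigma> v
  proof -
    have mem: "\<sigma> k \<in> {1..2^M}" if "k \<in> {1..K}" for k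
      using \<sigma> that unfolding sample_space_def by blast
    show ?thesis
      unfolding \<psi>_def \<phi>_def
      by (intro continuous_intros continuous_on_evolve_gap matrix_vector_mul_linear R'_diss A'_diss mem grid)
  qed

  have pathwise: "(v \<bullet> (xh \<sigma> \<tau> - x \<sigma> \<tau>))\<^sup>2
      \<le> 2 * (norm x0)\<^sup>2 * (norm (\<psi> \<sigma> v 0 - \<phi> v 0))\<^sup>2
        + 2 * (op_norm B)\<^sup>2 * U\<^sup>2 * integral {0..\<tau>} (\<lambda>r. (norm (\<psi> \<sigma> v r - \<phi> v r))\<^sup>2)"
    if \<sigma>: "\<sigma> \<in> sample_space M K" for \<sigma> v
  proof -
    have mem: "\<sigma> k \<in> {1..2^M}" if "k \<in> {1..K}" for k
      using \<sigma> that unfolding sample_space_def by blast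
    let ?d = "\<lambda>r. \<psi> \<sigma> v r - \<phi> v r"
    let ?a = "integral {0..\<tau>} (\<lambda>r. (norm (?d r))\<^sup>2)"
    have ivp: "solves_ivp T (\<lambda>s y. A *v y + B *v u \<sigma> s) x0 (x \<sigma>)"
      "solves_ivp T (\<lambda>s y. split_matrix M S p As K t \<sigma> s *v y + B *v u \<sigma> s) x0 (xh \<sigma>)"
      using x xh \<sigma> by auto
    have "((\<lambda>r. \<psi> \<sigma> v r \<bullet> (B *v u \<sigma> r)) has_integral v \<bullet> xh \<sigma> \<tau> - \<psi> \<sigma> v 0 \<bullet> xh \<sigma> 0) {0..\<tau>}"
      unfolding \<psi>_def
    proof (rule evolve_gap_duality[where L="\<lambda>k. (*v) (R (\<sigma> k))" and G="\<lambda>s y. split_matrix M S p As K t \<sigma> s *v y"])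
      show "split_matrix M S p As K t \<sigma> s *v y = R (\<sigma> k) *v y"
        if "k \<in> {1..K}" "t (k - 1) < s" "s < t k" for k s y
      proof -
        have "split_matrix M S p As K t \<sigma> s = R (\<sigma> k)"
          unfolding R_def using grid(1) that by (rule split_matrix_on_cell)
        then show ?thesis by simp
      qed
    qed (use ivp(2) lin R'_diss mem grid t \<tau> in \<open>auto simp: solves_ivp_def dot_lmul_matrix\<close>)
    moreover have "((\<lambda>r. \<phi> v r \<bullet> (B *v u \<sigma> r)) has_integral v \<bullet> x \<sigma> \<tau> - \<phi> v 0 \<bullet> x \<sigma> 0) {0..\<tau>}"
      unfolding \<phi>_def
      by (rule evolve_gap_duality[where L="\<lambda>_. (*v) A" and G="\<lambda>_. (*v) A"])
         (use ivp(1) lin A'_diss grid t \<tau> in \<open>auto simp: solves_ivp_def dot_lmul_matrix\<close>)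
    ultimately have "((\<lambda>r. ?d r \<bullet> (B *v u \<sigma> r)) has_integral
        (v \<bullet> xh \<sigma> \<tau> - \<psi> \<sigma> v 0 \<bullet> xh \<sigma> 0) - (v \<bullet> x \<sigma> \<tau> - \<phi> v 0 \<bullet> x \<sigma> 0)) {0..\<tau>}"
      unfolding inner_diff_left by (rule has_integral_diff)
    moreover define J where "J = v \<bullet> (xh \<sigma> \<tau> - x \<sigma> \<tau>) - ?d 0 \<bullet> x0"
    moreover have "x \<sigma> 0 = x0" "xh \<sigma> 0 = x0"
      using ivp by (auto simp: solves_ivp_def)
    then have "(v \<bullet> xh \<sigma> \<tau> - \<psi> \<sigma> v 0 \<bullet> xh \<sigma> 0) - (v \<bullet> x \<sigma> \<tau> - \<phi> v 0 \<bullet> x \<sigma> 0) = J"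
      by (simp add: J_def inner_diff_left inner_diff_right)
    ultimately have J: "((\<lambda>r. ?d r \<bullet> (B *v u \<sigma> r)) has_integral J) {0..\<tau>}"
      by simp
    obtain b where b: "((\<lambda>r. (norm (u \<sigma> r))\<^sup>2) has_integral b) {0..\<tau>}" "b \<le> U\<^sup>2"
      using square_integrable_on_has_integral u \<sigma> \<open>U \<ge> 0\<close> \<tau> by metis
    have a: "((\<lambda>r. (norm (?d r))\<^sup>2) has_integral ?a) {0..\<tau>}"
      by (intro integrable_integral integrable_continuous_interval cont \<sigma>)
    then have "0 \<le> ?a" by (rule has_integral_nonneg) simp
    have "((\<lambda>r. (op_norm B * norm (u \<sigma> r))\<^sup>2) has_integral (op_norm B)\<^sup>2 * b) {0..\<tau>}"
      unfolding power_mult_distrib by (intro has_integral_mult_right b)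
    then have "J\<^sup>2 \<le> ?a * ((op_norm B)\<^sup>2 * b)"
    proof (rule has_integral_Cauchy_Schwarz[OF J a])
      show "\<bar>?d r \<bullet> (B *v u \<sigma> r)\<bar> \<le> norm (?d r) * (op_norm B * norm (u \<sigma> r))" for r
        by (intro order_trans[OF Cauchy_Schwarz_ineq2] mult_left_mono norm_mult_vec_le_op_norm norm_ge_zero)
    qed
    also have "\<dots> \<le> ?a * ((op_norm B)\<^sup>2 * U\<^sup>2)"
      using b(2) \<open>0 \<le> ?a\<close> by (intro mult_left_mono) auto
    finally have J2: "J\<^sup>2 \<le> (op_norm B)\<^sup>2 * U\<^sup>2 * ?a"
      by (simp add: ac_simps)
    have "\<bar>?d 0 \<bullet> x0\<bar> \<le> norm (?d 0) * norm x0"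
      by (rule Cauchy_Schwarz_ineq2)
    then have "(?d 0 \<bullet> x0)\<^sup>2 \<le> (norm x0)\<^sup>2 * (norm (?d 0))\<^sup>2"
      using power_mono[of "\<bar>?d 0 \<bullet> x0\<bar>" "norm (?d 0) * norm x0" 2]
      by (simp add: power_mult_distrib mult.commute)
    moreover have "(v \<bullet> (xh \<sigma> \<tau> - x \<sigma> \<tau>))\<^sup>2 \<le> 2 * (?d 0 \<bullet> x0)\<^sup>2 + 2 * J\<^sup>2"
    proof -
      have "v \<bullet> (xh \<sigma> \<tau> - x \<sigma> \<tau>) = ?d 0 \<bullet> x0 + J" by (simp add: J_def)
      then show ?thesis
        using sum_squares_bound[of "?d 0 \<bullet> x0" J] by (simp only: power2_sum)
    qed
    ultimately show ?thesis using J2 by (simp add: mult.assoc)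
  qed

  have component: "expect M p K (\<lambda>\<sigma>. (v \<bullet> (xh \<sigma> \<tau> - x \<sigma> \<tau>))\<^sup>2)
      \<le> 6 * T * ((norm x0)\<^sup>2 + (op_norm B)\<^sup>2 * U\<^sup>2 * T) * h * V" if v: "norm v = 1" for v
  proof -
    let ?F = "\<lambda>\<sigma> r. (norm (\<psi> \<sigma> v r - \<phi> v r))\<^sup>2"
    let ?c = "3 * V * (h * T)"
    have "expect M p K (\<lambda>\<sigma>. (v \<bullet> (xh \<sigma> \<tau> - x \<sigma> \<tau>))\<^sup>2)
      \<le> expect M p K (\<lambda>\<sigma>. 2 * (norm x0)\<^sup>2 * ?F \<sigma> 0 + 2 * (op_norm B)\<^sup>2 * U\<^sup>2 * integral {0..\<tau>} (?F \<sigma>))"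
      using p by (intro expect_mono pathwise) auto
    also have "\<dots> = 2 * (norm x0)\<^sup>2 * expect M p K (\<lambda>\<sigma>. ?F \<sigma> 0)
        + 2 * (op_norm B)\<^sup>2 * U\<^sup>2 * expect M p K (\<lambda>\<sigma>. integral {0..\<tau>} (?F \<sigma>))"
      by (simp add: expect_add expect_cmult)
    also have "\<dots> \<le> 2 * (norm x0)\<^sup>2 * ?c + 2 * (op_norm B)\<^sup>2 * U\<^sup>2 * (?c * T)"
    proof (intro add_mono mult_left_mono)
      show "expect M p K (\<lambda>\<sigma>. ?F \<sigma> 0) \<le> ?c"
        using \<tau> v by (intro mean_square) auto
      have "((\<lambda>r. expect M p K (\<lambda>\<sigma>. ?F \<sigma> r)) has_integral expect M p K (\<lambda>\<sigma>. integral {0..\<tau>} (?F \<sigma>))) {0..\<tau>}"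
        unfolding expect_def
        by (intro has_integral_sum has_integral_mult_left integrable_integral
            integrable_continuous_interval cont)
           (auto simp: sample_space_def intro: finite_PiE)
      moreover have "((\<lambda>r. ?c) has_integral ?c * \<tau>) {0..\<tau>}"
        using has_integral_const_real[of ?c 0 \<tau>] \<tau> by (simp add: mult.commute)
      ultimately have "expect M p K (\<lambda>\<sigma>. integral {0..\<tau>} (?F \<sigma>)) \<le> ?c * \<tau>"
        by (rule has_integral_le) (intro mean_square v)
      also have "\<dots> \<le> ?c * T" using V h \<tau> \<open>T > 0\<close> by (intro mult_left_mono) auto
      finally show "expect M p K (\<lambda>\<sigma>. integral {0..\<tau>} (?F \<sigma>)) \<le> ?c * T" .
    qed auto
    also have "\<dots> = 6 * T * ((norm x0)\<^sup>2 + (op_norm B)\<^sup>2 * U\<^sup>2 * T) * h * V"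
      by (simp add: algebra_simps)
    finally show ?thesis .
  qed
  have "expect M p K (\<lambda>\<sigma>. (norm (xh \<sigma> \<tau> - x \<sigma> \<tau>))\<^sup>2)
      = (\<Sum>b\<in>Basis. expect M p K (\<lambda>\<sigma>. (b \<bullet> (xh \<sigma> \<tau> - x \<sigma> \<tau>))\<^sup>2))"
    unfolding expect_sum[symmetric] power2_norm_eq_inner
    by (subst euclidean_inner) (simp add: power2_eq_square inner_commute)
  also have "\<dots> \<le> (\<Sum>b\<in>(Basis::(real^'n) set). 6 * T * ((norm x0)\<^sup>2 + (op_norm B)\<^sup>2 * U\<^sup>2 * T) * h * V)"
    by (intro sum_mono component) simp
  also have "\<dots> = ?C * h * V" by simp
  finally show "expect M p K (\<lambda>\<omega>. (norm (xh \<omega> s - x \<omega> s))\<^sup>2)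
      \<le> ?C * max_spacing K t * splitting_variance M S p As A"
    by (simp only: \<tau>_def h_def V_def)
qed

end
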